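(* Let $N\ge 2$, let $m_1,\dots,m_N>0$ be masses, $G>0$, and let $q_i^0,v_i^0\in\mathbb{R}^3$ ($1\le i\le N$) satisfy $q_i^0\neq q_j^0$ for all $1\le i<j\le N$. Then the solution $(q(t),v(t))$ of the $N$-body problem $$\frac{dq_i}{dt}=v_i,\qquad \frac{dv_i}{dt}=\sum_{j\neq i}\frac{G\,m_j}{\|q_i-q_j\|^3}(q_j-q_i),\qquad q_i(0)=q_i^0,\quad v_i(0)=v_i^0,\qquad i=1,\ldots,N,$$ admits a holomorphic extension as a function of the complex time $t$ in the disk $$\left\{t\in\mathbb{C}\ :\ |t|<\frac{r(\eta_0)}{\sqrt{\mu_0^2+\nu_0}}\right\}.$$
   Context: $\|\cdot\|$ is the Euclidean norm on $\mathbb{R}^3$. With $K_i(q)=\sum_{j\neq i}\frac{G\,m_j}{\|q_i-q_j\|^2}$ and $M_{ij}(q)=K_i(q)+K_j(q)$, set $$\mu_0=\max_{1\le i<j\le N}\frac{\|v_i^0-v_j^0\|}{\|q_i^0-q_j^0\|},\qquad \nu_0=\max_{1\le i<j\le N}\frac{M_{ij}(q^0)}{\|q_i^0-q_j^0\|},\qquad \eta_0=\frac{\mu_0^2}{\mu_0^2+\nu_0}\in[0,1).$$ The function $r$ is $$r(\eta)=\int_0^{\sqrt2-1}\Big(\eta+2(1-\eta)\big((1-2\sigma-\sigma^2)^{-1/2}-1\big)\Big)^{-1/2}d\sigma,$$ (a convergent improper integral when $\eta=0$). *)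

theory Defs
  imports "HOL-Analysis.Analysis"
begin

text \<open>Bodies are indexed by a finite type \<open>'n\<close>, so that $N$ is \<open>CARD('n)\<close>.\<close>

definition nbody_accel :: "real \<Rightarrow> real^'n \<Rightarrow> real^3^'n \<Rightarrow> 'n \<Rightarrow> real^3" where
  "nbody_accel G m q i =
     (\<Sum>j\<in>UNIV - {i}. (G * m $ j / norm (q $ i - q $ j) ^ 3) *\<^sub>R (q $ j - q $ i))"

text \<open>A solution lives on an open interval around 0 and is free of collisions there; without the
  latter requirement, division by zero would give the equations a spurious meaning at a collision.\<close>

definition nbody_solution ::
  "real \<Rightarrow> real^'n \<Rightarrow> real^3^'n \<Rightarrow> real^3^'n \<Rightarrow>
   real set \<Rightarrow> (real \<Rightarrow> real^3^'n) \<Rightarrow> (real \<Rightarrow> real^3^'n) \<Rightarrow> bool" where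
  "nbody_solution G m q0 v0 J q v \<longleftrightarrow>
     open J \<and> is_interval J \<and> 0 \<in> J \<and>
     q 0 = q0 \<and> v 0 = v0 \<and>
     (\<forall>t\<in>J. \<forall>i j. i \<noteq> j \<longrightarrow> q t $ i \<noteq> q t $ j) \<and>
     (\<forall>t\<in>J. \<forall>i.
        ((\<lambda>s. q s $ i) has_vector_derivative v t $ i) (at t) \<and>
        ((\<lambda>s. v s $ i) has_vector_derivative nbody_accel G m (q t) i) (at t))"

definition nbody_K :: "real \<Rightarrow> real^'n \<Rightarrow> real^3^'n \<Rightarrow> 'n \<Rightarrow> real" where
  "nbody_K G m q i = (\<Sum>j\<in>UNIV - {i}. G * m $ j / (norm (q $ i - q $ j))\<^sup>2)"

definition nbody_M :: "real \<Rightarrow> real^'n \<Rightarrow> real^3^'n \<Rightarrow> 'n \<Rightarrow> 'n \<Rightarrow> real" where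
  "nbody_M G m q i j = nbody_K G m q i + nbody_K G m q j"

text \<open>The quantities below are symmetric in \<open>i\<close> and \<open>j\<close>, so the maximum over $i < j$ is the
  maximum over \<open>i \<noteq> j\<close>; no order on \<open>'n\<close> is needed.\<close>

definition nbody_mu :: "real^3^'n \<Rightarrow> real^3^'n \<Rightarrow> real" where
  "nbody_mu q0 v0 = Max {norm (v0 $ i - v0 $ j) / norm (q0 $ i - q0 $ j) | i j. i \<noteq> j}"

definition nbody_nu :: "real \<Rightarrow> real^'n \<Rightarrow> real^3^'n \<Rightarrow> real" where
  "nbody_nu G m q0 = Max {nbody_M G m q0 i j / norm (q0 $ i - q0 $ j) | i j. i \<noteq> j}"

definition nbody_eta :: "real \<Rightarrow> real^'n \<Rightarrow> real^3^'n \<Rightarrow> real^3^'n \<Rightarrow> real" where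
  "nbody_eta G m q0 v0 =
     (nbody_mu q0 v0)\<^sup>2 / ((nbody_mu q0 v0)\<^sup>2 + nbody_nu G m q0)"

text \<open>For \<open>0 \<le> \<eta> < 1\<close> the integrand is nonnegative and absolutely integrable. It is singular at
  most at the two endpoints, where \<open>0 powr a = 0\<close> gives it an irrelevant value, so this integral is
  also the value of the improper one.\<close>

definition nbody_r :: "real \<Rightarrow> real" where
  "nbody_r \<eta> = integral {0..sqrt 2 - 1}
     (\<lambda>\<sigma>. (\<eta> + 2 * (1 - \<eta>) * ((1 - 2 * \<sigma> - \<sigma>\<^sup>2) powr (-1/2) - 1)) powr (-1/2))"

definition nbody_radius :: "real \<Rightarrow> real^'n \<Rightarrow> real^3^'n \<Rightarrow> real^3^'n \<Rightarrow> real" where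
  "nbody_radius G m q0 v0 =
     nbody_r (nbody_eta G m q0 v0) / sqrt ((nbody_mu q0 v0)\<^sup>2 + nbody_nu G m q0)"

end

theory Submission
  imports Defs "HOL-Complex_Analysis.Cauchy_Integral_Formula"
begin

text \<open>
  The equations make sense for complex configurations once $\|w\|^2$ is replaced by the quadratic
  form $w \cdot w = \sum_k w_k^2$ and its root by the principal branch. This is legitimate as long
  as every difference $q_j - q_i$ stays within $x\,\|q_j^0 - q_i^0\|$ of its initial value for some
  $x < \sqrt 2 - 1$: then the real part of $w \cdot w$ is at least
  $\|q_j^0 - q_i^0\|^2 (1 - 2x - x^2) > 0$. In that region the relative acceleration of two bodies
  is at most $\nu_0 \|q_i^0 - q_j^0\|\, f(x)$ with $f(x) = (1+x)(1-2x-x^2)^{-3/2}$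
  (\<open>cforce_pair_bound\<close>).

  Hence the relative displacements are controlled along every ray of complex time by the scalar
  comparison equation $\sigma'' = \nu_0 f(\sigma)$ with $\sigma'(0) \ge \mu_0$. It has the energy
  integral $\sigma'^2 = E(\sigma)$, where
  $E(x) = \mu_0^2 + 2\nu_0((1-2x-x^2)^{-1/2} - 1)$, and so its solution needs the time
  $\int_0^{\sqrt2-1} E^{-1/2}$ to climb from $0$ to $\sqrt 2 - 1$. By scaling, this time is exactly
  the claimed radius $R$ (\<open>nbody_r_eq_escape_time\<close>). Starting the comparison solution at a small
  $a > 0$ instead of $0$ costs arbitrarily little time and removes the singularity of $E^{-1/2}$ at
  $0$ that occurs when $\mu_0 = 0$; thus for every $\rho < R$ there is a comparison function on
  $[0, \rho]$ (\<open>majorant_exists\<close>).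

  The bound by the comparison functions is preserved by Picard iteration on the whole disk of radius
  $R$ (\<open>majorized_admissible\<close>), where the iterates are obtained from primitives of holomorphic
  functions. On smaller disks the force is Lipschitz on the region that the iterates occupy, so they
  converge locally uniformly and the limit is a holomorphic solution
  (\<open>holomorphic_solution\<close>). Gronwall's inequality gives uniqueness for the complexified
  equations in real time (\<open>csolution_unique\<close>). It yields both remaining claims: the holomorphic
  solution is real on the real axis, because its complex conjugate solves the same problem, and it
  agrees there with every real solution.
\<close>

section \<open>Vector-valued holomorphic functions and bounds along rays\<close>

lemma has_vector_derivative_vec:
  fixes f :: "real \<Rightarrow> 'a::real_normed_vector ^ 'n"
  assumes "\<And>i. ((\<lambda>t. f t $ i) has_vector_derivative f' $ i) (at x within S)"
  shows "(f has_vector_derivative f') (at x within S)"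
proof -
  have "((\<lambda>y. \<chi> i. (1 / norm (y - x)) *\<^sub>R (f y $ i - (f x $ i + (y - x) *\<^sub>R f' $ i)))
      \<longlongrightarrow> (\<chi> i. 0)) (at x within S)"
    using assms unfolding has_vector_derivative_def has_derivative_within
    by (intro tendsto_vec_lambda) blast
  moreover have "(\<chi> i. (1 / norm (y - x)) *\<^sub>R (f y $ i - (f x $ i + (y - x) *\<^sub>R f' $ i)))
      = (1 / norm (y - x)) *\<^sub>R (f y - (f x + (y - x) *\<^sub>R f'))" for y
    by (simp add: vec_eq_iff)
  moreover have "(\<chi> i. 0) = (0 :: 'a ^ 'n)"
    by (simp add: vec_eq_iff)
  ultimately show ?thesis
    unfolding has_vector_derivative_def has_derivative_within
    by (simp add: bounded_linear_scaleR_left)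
qed

definition cderiv_on :: "complex set \<Rightarrow> (complex \<Rightarrow> complex^'k^'n) \<Rightarrow> (complex \<Rightarrow> complex^'k^'n) \<Rightarrow> bool" where
  "cderiv_on S Q V \<longleftrightarrow>
     (\<forall>z\<in>S. \<forall>i k. ((\<lambda>w. Q w $ i $ k) has_field_derivative V z $ i $ k) (at z))"

text \<open>
  Multiplication by a complex scalar on nested vectors, which carry only a real vector space
  structure as a type class instance.
\<close>

definition cscale :: "complex \<Rightarrow> complex^'k^'n \<Rightarrow> complex^'k^'n" where
  "cscale c x = (\<chi> i. c *s (x $ i))"

lemma norm_vector_smult: "norm (c *s (x :: complex^'k)) = norm c * norm x"
  unfolding norm_vec_def by (simp add: norm_mult L2_set_right_distrib)

lemma norm_cscale: "norm (cscale c x) = norm c * norm x"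
proof -
  have "norm (cscale c x) = L2_set (\<lambda>i. norm c * norm (x $ i)) UNIV"
    unfolding cscale_def norm_vec_def[of "vec_lambda _"] by (simp add: norm_vector_smult)
  then show ?thesis
    by (simp add: L2_set_right_distrib norm_vec_def[of x])
qed

lemma cderiv_on_ray:
  assumes "cderiv_on S Q V" "of_real s * e \<in> S"
  shows "((\<lambda>s. Q (of_real s * e)) has_vector_derivative cscale e (V (of_real s * e))) (at s)"
proof (intro has_vector_derivative_vec)
  fix i k
  have 1: "((\<lambda>s. of_real s * e) has_vector_derivative e) (at s)"
    by (auto intro!: derivative_eq_intros simp: has_vector_derivative_def scaleR_conv_of_real)
  have 2: "((\<lambda>w. Q w $ i $ k) has_field_derivative V (of_real s * e) $ i $ k) (at (of_real s * e))"
    using assms unfolding cderiv_on_def by auto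
  show "((\<lambda>s. Q (of_real s * e) $ i $ k) has_vector_derivative cscale e (V (of_real s * e)) $ i $ k) (at s)"
    using field_vector_diff_chain_at[OF 1 2] by (simp add: o_def cscale_def)
qed

lemma cderiv_on_continuous:
  assumes "cderiv_on S Q V"
  shows "continuous_on S Q"
proof -
  have "continuous_on S (\<lambda>z. \<chi> i. \<chi> k. Q z $ i $ k)"
    using assms unfolding cderiv_on_def
    by (intro continuous_on_vec_lambda continuous_at_imp_continuous_on ballI)
      (meson DERIV_isCont)
  then show ?thesis by simp
qed

text \<open>
  The comparison principle behind all growth estimates: along the ray from \<open>0\<close> through \<open>z\<close>, the
  mean value inequality bounds the increment of \<open>Q\<close> by that of a real function of $|z|$. The map \<open>p\<close>
  selects the quantity to be measured, either the whole vector or a difference of two blocks;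
  the direction of the ray enters only through a unit factor, to which the norm of \<open>p\<close> is blind.
\<close>

lemma ray_mean_value:
  fixes Q V :: "complex \<Rightarrow> complex^'k^'n" and p :: "complex^'k^'n \<Rightarrow> 'b::real_normed_vector"
  assumes QV: "cderiv_on (ball 0 R) Q V" and z: "norm z < R"
    and p: "bounded_linear p" and unit: "\<And>e x. norm e = 1 \<Longrightarrow> norm (p (cscale e x)) = norm (p x)"
    and cont: "continuous_on {0..norm z} \<phi>"
    and der: "\<And>t. 0 < t \<Longrightarrow> t < norm z \<Longrightarrow> (\<phi> has_real_derivative \<phi>' t) (at t)"
    and bound: "\<And>w. 0 < norm w \<Longrightarrow> norm w < norm z \<Longrightarrow> norm (p (V w)) \<le> \<phi>' (norm w)"
  shows "norm (p (Q z) - p (Q 0)) \<le> \<phi> (norm z) - \<phi> 0"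
proof (cases "z = 0")
  case False
  define e where "e = sgn z"
  have e: "norm e = 1" using False by (simp add: e_def norm_sgn)
  have ze: "of_real (norm z) * e = z"
    by (metis e_def False mult.commute mult_sgn_abs scaleR_conv_of_real sgn_div_norm sgn_zero_iff
        divideR_right norm_eq_zero)
  have inb: "of_real s * e \<in> ball 0 R" if "0 \<le> s" "s \<le> norm z" for s
    using that z e by (simp add: norm_mult)
  have D: "((\<lambda>s. p (Q (of_real s * e))) has_vector_derivative p (cscale e (V (of_real s * e)))) (at s)"
    if "0 \<le> s" "s \<le> norm z" for s
    using bounded_linear.has_vector_derivative[OF p cderiv_on_ray[OF QV inb[OF that]]] .
  have "norm (p (Q (of_real (norm z) * e)) - p (Q (of_real 0 * e))) \<le> \<phi> (norm z) - \<phi> 0"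
  proof (rule differentiable_bound_general[where f' = "\<lambda>s. p (cscale e (V (of_real s * e)))" and \<phi>' = \<phi>'
        and f = "\<lambda>s. p (Q (of_real s * e))"])
    show "continuous_on {0..norm z} (\<lambda>s. p (Q (of_real s * e)))"
      by (rule continuous_at_imp_continuous_on) (auto intro!: has_vector_derivative_continuous[OF D])
    show "(\<phi> has_vector_derivative \<phi>' x) (at x)" if "0 < x" "x < norm z" for x
      using der[OF that] has_real_derivative_iff_has_vector_derivative by blast
    show "norm (p (cscale e (V (of_real x * e)))) \<le> \<phi>' x" if "0 < x" "x < norm z" for x
      using bound[of "of_real x * e"] that e by (simp add: unit norm_mult)
  qed (use False cont D in auto)
  then show ?thesis by (simp add: ze)
qed simp

section \<open>The scalar comparison equation\<close>

text \<open>
  The function $f$ of the comparison equation. It is the derivative of $(1-2x-x^2)^{-1/2}$, so that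
  $\sigma'' = \nu f(\sigma)$ is conservative.
\<close>

definition growth :: "real \<Rightarrow> real" where
  "growth x = (1 + x) / sqrt (1 - 2 * x - x\<^sup>2) ^ 3"

text \<open>
  The square of the speed at height $x$ of the solution of $\sigma'' = \nu f(\sigma)$ that starts at
  $0$ with speed $\mu$.
\<close>

definition energy :: "real \<Rightarrow> real \<Rightarrow> real \<Rightarrow> real" where
  "energy \<mu> \<nu> x = \<mu>\<^sup>2 + 2 * \<nu> * (1 / sqrt (1 - 2 * x - x\<^sup>2) - 1)"

lemma shrink_pos:
  fixes x :: real
  assumes "0 \<le> x" "x < sqrt 2 - 1"
  shows "0 < 1 - 2 * x - x\<^sup>2"
proof -
  have "(1 + x)\<^sup>2 < (sqrt 2)\<^sup>2"
    using assms by (intro power_strict_mono) auto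
  then show ?thesis by (simp add: power2_eq_square algebra_simps)
qed

text \<open>
  With $y = 1-2x-x^2$ one has $(1+x)^2 = 2 - y$, hence $y(1+x)^2 = 1 - (1-y)^2 \le 1$ and
  $y^{-1/2} \ge 1 + x$. The linear lower bound makes $E^{-1/2}$ integrable at $0$ even for $\mu = 0$.
\<close>

lemma energy_lower:
  assumes "0 \<le> x" "x < sqrt 2 - 1" "0 \<le> \<nu>"
  shows "\<mu>\<^sup>2 + 2 * \<nu> * x \<le> energy \<mu> \<nu> x"
proof -
  define y where "y = 1 - 2 * x - x\<^sup>2"
  have y: "0 < y" using shrink_pos[OF assms(1,2)] by (simp add: y_def)
  have "y * (1 + x)\<^sup>2 = 1 - (1 - y)\<^sup>2"
    by (simp add: y_def power2_eq_square algebra_simps)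
  then have "sqrt (y * (1 + x)\<^sup>2) \<le> sqrt 1"
    by (intro real_sqrt_le_mono) simp
  then have "sqrt y * (1 + x) \<le> 1"
    using assms(1) by (simp add: real_sqrt_mult)
  then have "1 + x \<le> 1 / sqrt y"
    using y by (simp add: field_simps)
  then have "2 * \<nu> * x \<le> 2 * \<nu> * (1 / sqrt y - 1)"
    using assms(3) by (intro mult_left_mono) auto
  then show ?thesis by (simp add: energy_def y_def)
qed

lemma energy_pos:
  assumes "0 < x" "x < sqrt 2 - 1" "0 < \<nu>"
  shows "0 < energy \<mu> \<nu> x"
proof -
  have "0 < \<mu>\<^sup>2 + 2 * \<nu> * x" using assms by (simp add: add_nonneg_pos)
  then show ?thesis using energy_lower[of x \<nu> \<mu>] assms by linarith
qed

lemma energy_deriv: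
  assumes "0 \<le> x" "x < sqrt 2 - 1"
  shows "(energy \<mu> \<nu> has_real_derivative 2 * \<nu> * growth x) (at x)"
proof -
  note p = shrink_pos[OF assms]
  have "((\<lambda>x. 1 / sqrt (1 - 2 * x - x\<^sup>2)) has_real_derivative growth x) (at x)"
    using p by (auto intro!: derivative_eq_intros
        simp: growth_def divide_simps power2_eq_square power3_eq_cube)
  from DERIV_add[OF DERIV_const[of "\<mu>\<^sup>2"] DERIV_cmult[OF DERIV_diff[OF this DERIV_const[of 1]], of "2 * \<nu>"]]
  show ?thesis by (simp add: energy_def[abs_def])
qed

lemma energy_continuous_on: "continuous_on {0<..<sqrt 2 - 1} (energy \<mu> \<nu>)"
  by (rule continuous_at_imp_continuous_on) (auto intro!: DERIV_isCont energy_deriv)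

lemma inverse_speed_continuous_on:
  assumes "0 < \<nu>"
  shows "continuous_on {0<..<sqrt 2 - 1} (\<lambda>x. 1 / sqrt (energy \<mu> \<nu> x))"
proof (intro continuous_intros energy_continuous_on ballI)
  fix x assume "x \<in> {0<..<sqrt 2 - 1}"
  then show "sqrt (energy \<mu> \<nu> x) \<noteq> 0" using energy_pos[of x \<nu> \<mu>] assms by simp
qed

lemma inverse_speed_integrable:
  assumes "0 < \<nu>"
  shows "(\<lambda>x. 1 / sqrt (energy \<mu> \<nu> x)) integrable_on {0..sqrt 2 - 1}"
proof -
  have "(\<lambda>x. 1 / sqrt (energy \<mu> \<nu> x)) integrable_on {0<..<sqrt 2 - 1}"
  proof (rule measurable_bounded_by_integrable_imp_integrable_real)
    show "(\<lambda>x. 1 / sqrt (energy \<mu> \<nu> x)) \<in> borel_measurable (lebesgue_on {0<..<sqrt 2 - 1})"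
      by (intro continuous_imp_measurable_on_sets_lebesgue inverse_speed_continuous_on assms) simp
    have "(\<lambda>x::real. (1 / sqrt (2 * \<nu>)) * x powr (-1/2)) integrable_on {0..sqrt 2 - 1}"
      by (intro integrable_on_mult_right integrable_on_powr_from_0) auto
    then show "(\<lambda>x::real. (1 / sqrt (2 * \<nu>)) * x powr (-1/2)) integrable_on {0<..<sqrt 2 - 1}"
      by (simp only: integrable_on_open_interval_real)
    fix x :: real assume x: "x \<in> {0<..<sqrt 2 - 1}"
    have "2 * \<nu> * x \<le> energy \<mu> \<nu> x"
      using energy_lower[of x \<nu> \<mu>] x assms by (smt (verit) greaterThanLessThan_iff zero_le_power2)
    then have "1 / sqrt (energy \<mu> \<nu> x) \<le> 1 / sqrt (2 * \<nu> * x)"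
      using x assms by (intro divide_left_mono) (auto intro!: mult_pos_pos energy_pos)
    also have "\<dots> = (1 / sqrt (2 * \<nu>)) * x powr (-1/2)"
      using x by (simp add: real_sqrt_mult powr_minus_divide powr_half_sqrt)
    finally show "\<bar>1 / sqrt (energy \<mu> \<nu> x)\<bar> \<le> (1 / sqrt (2 * \<nu>)) * x powr (-1/2)"
      using energy_pos[of x \<nu> \<mu>] x assms by simp
  qed simp
  then show ?thesis by (simp only: integrable_on_open_interval_real)
qed

text \<open>
  Taking $\mu^2 + \nu$ out of the energy $E$ leaves
  $\eta + 2(1-\eta)((1-2x-x^2)^{-1/2} - 1)$ with $\eta = \mu^2/(\mu^2+\nu)$, so the time that the
  comparison solution needs to reach $\sqrt 2 - 1$ is the radius of the disk.
\<close>

lemma nbody_r_eq_escape_time: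
  assumes "0 < \<nu>"
  shows "nbody_r (\<mu>\<^sup>2 / (\<mu>\<^sup>2 + \<nu>)) / sqrt (\<mu>\<^sup>2 + \<nu>)
    = integral {0..sqrt 2 - 1} (\<lambda>x. 1 / sqrt (energy \<mu> \<nu> x))"
proof -
  define k where "k = \<mu>\<^sup>2 + \<nu>"
  have k: "0 < k" using assms by (simp add: k_def add_nonneg_pos)
  have "nbody_r (\<mu>\<^sup>2 / k) = integral {0..sqrt 2 - 1} (\<lambda>x. sqrt k * (1 / sqrt (energy \<mu> \<nu> x)))"
    unfolding nbody_r_def
    (* At the endpoints the expressions under the roots may vanish, and the two integrands
       take unrelated default values there. *)
  proof (rule integral_spike[where S = "{0, sqrt 2 - 1}"])
    fix x assume "x \<in> {0..sqrt 2 - 1} - {0, sqrt 2 - 1}"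
    then have x: "0 < x" "x < sqrt 2 - 1" by auto
    define y where "y = 1 - 2 * x - x\<^sup>2"
    have y: "0 < y" using shrink_pos[of x] x by (simp add: y_def)
    have "y powr (-1/2) = 1 / sqrt y"
      using y by (simp add: powr_minus_divide powr_half_sqrt)
    moreover have "1 - \<mu>\<^sup>2 / k = \<nu> / k"
      using k by (simp add: field_simps) (simp add: k_def)
    ultimately have "\<mu>\<^sup>2 / k + 2 * (1 - \<mu>\<^sup>2 / k) * (y powr (-1/2) - 1) = energy \<mu> \<nu> x / k"
      by (simp add: energy_def y_def add_divide_distrib)
    then show "sqrt k * (1 / sqrt (energy \<mu> \<nu> x)) =
        (\<mu>\<^sup>2 / k + 2 * (1 - \<mu>\<^sup>2 / k) * ((1 - 2 * x - x\<^sup>2) powr (-1/2) - 1)) powr (-1/2)"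
      using k energy_pos[OF x assms, of \<mu>]
      by (simp add: y_def powr_minus_divide powr_half_sqrt real_sqrt_divide)
  qed simp
  then show ?thesis using k unfolding k_def[symmetric] by (simp only: integral_mult_right) simp
qed

lemma escape_time_pos:
  assumes "0 < \<nu>"
  shows "0 < integral {0..sqrt 2 - 1} (\<lambda>x. 1 / sqrt (energy \<mu> \<nu> x))"
proof -
  let ?g = "\<lambda>x. 1 / sqrt (energy \<mu> \<nu> x)"
  have s: "1/4 < sqrt 2 - (1::real)"
  proof -
    have "sqrt ((5/4)\<^sup>2) < sqrt (2::real)" by (rule real_sqrt_less_mono) (simp add: power2_eq_square)
    then show ?thesis by simp
  qed
  have int: "?g integrable_on {0<..<sqrt 2 - 1}"
    using inverse_speed_integrable[OF assms] by (simp only: integrable_on_open_interval_real)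
  have int': "?g integrable_on {1/8..1/4}"
    by (rule integrable_on_subinterval[OF inverse_speed_integrable[OF assms]]) (use s in auto)
  (* Any compact interval inside (0, sqrt 2 - 1) would do; up to 1/4 the root in the energy
     is at least 1/2, which makes the bound explicit. *)
  have low: "1 / sqrt (\<mu>\<^sup>2 + 2 * \<nu>) \<le> ?g x" if x: "x \<in> {1/8..1/4}" for x
  proof -
    define y where "y = 1 - 2 * x - x\<^sup>2"
    have "x\<^sup>2 \<le> (1/4)\<^sup>2" using x by (intro power_mono) auto
    then have "(1/2)\<^sup>2 \<le> y" using x by (simp add: y_def power2_eq_square)
    then have "1/2 \<le> sqrt y" by (rule real_le_rsqrt)
    moreover from this have "0 < sqrt y" by linarith
    ultimately have "1 / sqrt y \<le> 2" by (simp only: divide_le_eq) simp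
    then have "\<nu> * (1 / sqrt y - 1) \<le> \<nu> * 1" using assms by (intro mult_left_mono) auto
    then have "energy \<mu> \<nu> x \<le> \<mu>\<^sup>2 + 2 * \<nu>" by (simp add: energy_def y_def)
    moreover have "0 < energy \<mu> \<nu> x" using energy_pos[of x] x s assms by simp
    ultimately show ?thesis by (intro divide_left_mono) auto
  qed
  have "0 < integral {1/8..1/4::real} (\<lambda>x. 1 / sqrt (\<mu>\<^sup>2 + 2 * \<nu>))"
    using assms by (simp add: add_nonneg_pos)
  also have "\<dots> \<le> integral {1/8..1/4} ?g"
    by (rule integral_le) (use int' low in auto)
  also have "\<dots> \<le> integral {0<..<sqrt 2 - 1} ?g"
    using energy_pos[OF _ _ assms] s by (intro integral_subset_le int int') (auto intro: less_imp_le)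
  finally show ?thesis by (simp only: integral_open_interval_real)
qed

text \<open>
  By continuity of the indefinite integral, both endpoints may be cut off at an arbitrarily small cost
  in time.
\<close>

lemma escape_time_inner_interval:
  assumes "0 < \<nu>" and \<rho>: "\<rho> < integral {0..sqrt 2 - 1} (\<lambda>x. 1 / sqrt (energy \<mu> \<nu> x))"
  obtains a b where "0 < a" "a < b" "b < sqrt 2 - 1"
    "\<rho> < integral {a..b} (\<lambda>x. 1 / sqrt (energy \<mu> \<nu> x))"
proof -
  let ?g = "\<lambda>x. 1 / sqrt (energy \<mu> \<nu> x)" and ?s = "sqrt 2 - (1::real)"
  define I where "I x = integral {0..x} ?g" for x
  note int = inverse_speed_integrable[OF assms(1), of \<mu>]
  have s: "0 < ?s" by simp
  have cont: "continuous_on {0..?s} I"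
    unfolding I_def by (rule indefinite_integral_continuous_1[OF int])
  have "(I \<longlongrightarrow> I ?s) (at_left ?s)"
    using cont s by (simp add: continuous_on_Icc_at_leftD)
  moreover have "\<rho> < I ?s" using \<rho> by (simp only: I_def)
  ultimately have "\<forall>\<^sub>F x in at_left ?s. \<rho> < I x"
    by (rule order_tendstoD(1))
  moreover have "\<forall>\<^sub>F x in at_left ?s. x \<in> {0<..<?s}"
    using s by (rule eventually_at_left_real)
  ultimately have "\<forall>\<^sub>F x in at_left ?s. \<rho> < I x \<and> x \<in> {0<..<?s}"
    by (rule eventually_conj)
  then obtain b where b: "\<rho> < I b" "0 < b" "b < ?s"
    using eventually_happens'[of "at_left ?s"] by auto
  have "(I \<longlongrightarrow> I 0) (at_right 0)"
    using cont s by (simp add: continuous_on_Icc_at_rightD)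
  moreover have "I 0 < I b - \<rho>" using b by (simp add: I_def)
  ultimately have "\<forall>\<^sub>F x in at_right 0. I x < I b - \<rho>"
    by (rule order_tendstoD(2))
  moreover have "\<forall>\<^sub>F x in at_right 0. x \<in> {0<..<b}"
    using b by (intro eventually_at_right_real)
  ultimately have "\<forall>\<^sub>F x in at_right (0::real). I x < I b - \<rho> \<and> x \<in> {0<..<b}"
    by (rule eventually_conj)
  then obtain a where a: "I a < I b - \<rho>" "0 < a" "a < b"
    using eventually_happens'[of "at_right (0::real)"] by auto
  have "?g integrable_on {0..b}"
    by (rule integrable_on_subinterval[OF int]) (use b in auto)
  then have "I a + integral {a..b} ?g = I b"
    unfolding I_def using a by (intro Henstock_Kurzweil_Integration.integral_combine) auto
  then show thesis using a b by (intro that[of a b]) auto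
qed

text \<open>
  A supersolution of the comparison equation on $[0, \rho]$. Its initial height is only required to be
  nonnegative, which leaves room to start above the singularity of $E^{-1/2}$ at $0$. The level \<open>s\<close>
  keeps it away from $\sqrt 2 - 1$, where control of the force is lost.
\<close>

definition majorant ::
  "real \<Rightarrow> real \<Rightarrow> real \<Rightarrow> real \<Rightarrow> (real \<Rightarrow> real) \<Rightarrow> (real \<Rightarrow> real) \<Rightarrow> bool" where
  "majorant \<mu> \<nu> \<rho> s \<sigma> \<sigma>' \<longleftrightarrow>
     s < sqrt 2 - 1 \<and> continuous_on {0..\<rho>} \<sigma> \<and> continuous_on {0..\<rho>} \<sigma>' \<and>
     (\<forall>t\<in>{0..\<rho>}. 0 \<le> \<sigma> t \<and> \<sigma> t \<le> s) \<and> \<mu> \<le> \<sigma>' 0 \<and>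
     (\<forall>t\<in>{0<..<\<rho>}. (\<sigma> has_real_derivative \<sigma>' t) (at t) \<and>
        (\<sigma>' has_real_derivative \<nu> * growth (\<sigma> t)) (at t))"

text \<open>
  On an inner interval $[a,b]$ the time $T(x) = \int_a^x E^{-1/2}$ is a smooth increasing function of
  the height with nonzero derivative; the majorant is its inverse function.
\<close>

lemma majorant_exists:
  assumes \<nu>: "0 < \<nu>"
    and \<rho>: "\<rho> < integral {0..sqrt 2 - 1} (\<lambda>x. 1 / sqrt (energy \<mu> \<nu> x))"
  obtains s \<sigma> \<sigma>' where "majorant \<mu> \<nu> \<rho> s \<sigma> \<sigma>'"
proof -
  let ?g = "\<lambda>x. 1 / sqrt (energy \<mu> \<nu> x)"
  obtain a b where ab: "0 < a" "a < b" "b < sqrt 2 - 1" and \<rho>ab: "\<rho> < integral {a..b} ?g"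
    using escape_time_inner_interval[OF \<nu> \<rho>] .
  define T where "T x = integral {a..x} ?g" for x
  have E: "0 < energy \<mu> \<nu> x" if "x \<in> {a..b}" for x
    using that ab by (intro energy_pos \<nu>) auto
  have gc: "continuous_on {a..b} ?g"
    by (rule continuous_on_subset[OF inverse_speed_continuous_on[OF \<nu>]]) (use ab in auto)
  have T': "(T has_real_derivative ?g x) (at x within {a..b})" if "x \<in> {a..b}" for x
    unfolding T_def by (rule integral_has_real_derivative[OF gc that])
  have Tc: "continuous_on {a..b} T"
    by (rule DERIV_continuous_on[OF T'])
  have Tmono: "T x < T y" if "a \<le> x" "x < y" "y \<le> b" for x y
  proof (rule DERIV_pos_imp_increasing_open[OF that(2)])
    fix z assume z: "x < z" "z < y"
    then have "(T has_real_derivative ?g z) (at z)"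
      using T'[of z] that by (simp add: at_within_Icc_at)
    then show "\<exists>y. (T has_real_derivative y) (at z) \<and> 0 < y"
      using E[of z] z that by (intro exI[of _ "?g z"]) auto
  qed (rule continuous_on_subset[OF Tc], use that in auto)
  have inj: "inj_on T {a..b}"
    by (intro linorder_inj_onI) (auto dest: Tmono)
  define \<sigma> where "\<sigma> = the_inv_into {a..b} T"
  have Ta: "T a = 0" by (simp add: T_def)
  have img: "{0..T b} \<subseteq> T ` {a..b}"
  proof
    fix y assume "y \<in> {0..T b}"
    then have "\<exists>x\<ge>a. x \<le> b \<and> T x = y"
      using Ta ab Tc by (intro IVT') auto
    then show "y \<in> T ` {a..b}" by auto
  qed
  have T\<sigma>: "T (\<sigma> t) = t" if "t \<in> {0..T b}" for t
    unfolding \<sigma>_def using img that by (intro f_the_inv_into_f[OF inj]) auto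
  have \<sigma>T: "\<sigma> (T x) = x" if "x \<in> {a..b}" for x
    unfolding \<sigma>_def using that by (intro the_inv_into_f_f[OF inj])
  have \<sigma>ab: "\<sigma> t \<in> {a..b}" if "t \<in> {0..T b}" for t
    using img that \<sigma>T by force
  have \<sigma>c: "continuous_on {0..T b} \<sigma>"
    by (rule continuous_on_subset[OF continuous_on_inv[OF Tc _ ] img]) (auto simp: \<sigma>T)
  have \<sigma>': "(\<sigma> has_real_derivative sqrt (energy \<mu> \<nu> (\<sigma> t))) (at t)" if t: "0 < t" "t < T b" for t
  proof -
    have s: "\<sigma> t \<in> {a..b}" and st: "T (\<sigma> t) = t" using \<sigma>ab T\<sigma> t by auto
    have "\<sigma> t \<noteq> a" "\<sigma> t \<noteq> b" using st t Ta by auto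
    then have s': "a < \<sigma> t" "\<sigma> t < b" using s by auto
    have "(\<sigma> has_real_derivative inverse (?g (\<sigma> t))) (at t)"
    proof (rule DERIV_inverse_function[where f = T])
      show "(T has_real_derivative ?g (\<sigma> t)) (at (\<sigma> t))"
        using T'[OF s] s' by (simp add: at_within_Icc_at)
      show "?g (\<sigma> t) \<noteq> 0" using E[OF s] by simp
      show "isCont \<sigma> t" using continuous_on_interior[OF \<sigma>c] t by simp
    qed (use t T\<sigma> in auto)
    then show ?thesis by simp
  qed
  have Tb: "\<rho> < T b" using \<rho>ab by (simp add: T_def)
  have \<sigma>a: "\<sigma> 0 = a" using \<sigma>T[of a] Ta ab by simp
  define \<sigma>d where "\<sigma>d t = sqrt (energy \<mu> \<nu> (\<sigma> t))" for t
  have "majorant \<mu> \<nu> \<rho> b \<sigma> \<sigma>d"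
    unfolding majorant_def
  proof (intro conjI ballI)
    have sub: "{0..\<rho>} \<subseteq> {0..T b}" using Tb by auto
    show "continuous_on {0..\<rho>} \<sigma>" using \<sigma>c sub continuous_on_subset by blast
    then show "continuous_on {0..\<rho>} \<sigma>d" unfolding \<sigma>d_def
      by (intro continuous_on_real_sqrt continuous_on_compose2[OF energy_continuous_on])
        (use \<sigma>ab ab sub in fastforce)+
    show "\<mu> \<le> \<sigma>d 0"
    proof -
      have "\<mu>\<^sup>2 \<le> energy \<mu> \<nu> a"
        using energy_lower[of a \<nu> \<mu>] ab \<nu> by (smt (verit) mult_nonneg_nonneg)
      then show ?thesis unfolding \<sigma>d_def \<sigma>a by (rule real_le_rsqrt)
    qed
    show "0 \<le> \<sigma> t" "\<sigma> t \<le> b" if "t \<in> {0..\<rho>}" for t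
      using \<sigma>ab[of t] that ab Tb by auto
    fix t assume "t \<in> {0<..<\<rho>}"
    then have t: "0 < t" "t < T b" and s: "\<sigma> t \<in> {a..b}" using Tb \<sigma>ab[of t] by auto
    show "(\<sigma> has_real_derivative \<sigma>d t) (at t)"
      using \<sigma>'[OF t] by (simp add: \<sigma>d_def)
    have "((\<lambda>t. energy \<mu> \<nu> (\<sigma> t)) has_real_derivative (2 * \<nu> * growth (\<sigma> t)) * sqrt (energy \<mu> \<nu> (\<sigma> t))) (at t)"
      by (rule DERIV_chain2[OF energy_deriv \<sigma>'[OF t]]) (use s ab in auto)
    then show "(\<sigma>d has_real_derivative \<nu> * growth (\<sigma> t)) (at t)"
      unfolding \<sigma>d_def using E[OF s]
      by (auto intro!: derivative_eq_intros simp: field_simps)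
  qed (use ab in auto)
  then show thesis by (rule that)
qed

section \<open>The complexified gravitational force\<close>

text \<open>
  The bilinear extension of the squared Euclidean norm, not the Hermitian one: only the former is
  holomorphic.
\<close>

definition cdot :: "complex^'k \<Rightarrow> complex" where
  "cdot w = (\<Sum>k\<in>UNIV. w $ k * w $ k)"

text \<open>
  The attraction by a unit mass. On real vectors it is $w / \|w\|^3$, and it is holomorphic where
  \<open>cdot w\<close> has positive real part.
\<close>

definition pull :: "complex^'k \<Rightarrow> complex^'k" where
  "pull w = (1 / csqrt (cdot w) ^ 3) *s w"

definition cvec :: "real^'k \<Rightarrow> complex^'k" where
  "cvec a = (\<chi> k. of_real (a $ k))"

definition cforce :: "real \<Rightarrow> real^'n \<Rightarrow> complex^3^'n \<Rightarrow> complex^3^'n" where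
  "cforce G m Q = (\<chi> i. \<Sum>j\<in>UNIV - {i}. of_real (G * m $ j) *s pull (Q $ j - Q $ i))"

definition cconf :: "real^'k^'n \<Rightarrow> complex^'k^'n" where
  "cconf q = (\<chi> i. cvec (q $ i))"

lemma norm_sum_mult_le:
  fixes u w :: "complex^'k"
  shows "norm (\<Sum>k\<in>UNIV. u $ k * w $ k) \<le> norm u * norm w"
proof -
  have "norm (\<Sum>k\<in>UNIV. u $ k * w $ k) \<le> (\<Sum>k\<in>UNIV. \<bar>norm (u $ k)\<bar> * \<bar>norm (w $ k)\<bar>)"
    by (rule order_trans[OF norm_sum]) (simp add: norm_mult)
  also have "\<dots> \<le> norm u * norm w"
    unfolding norm_vec_def by (rule L2_set_mult_ineq)
  finally show ?thesis .
qed

lemma norm_cvec [simp]: "norm (cvec a) = norm a"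
  unfolding norm_vec_def cvec_def by simp

lemma cvec_diff: "cvec (a - b) = cvec a - cvec b"
  by (simp add: cvec_def vec_eq_iff)

lemma cdot_cvec: "cdot (cvec a) = of_real ((norm a)\<^sup>2)"
  by (simp add: cdot_def cvec_def power2_norm_eq_inner inner_vec_def)

text \<open>
  Writing $w = a + d$, we have $w \cdot w = \|a\|^2 + 2\,a \cdot d + d \cdot d$, and the last two terms
  are bounded by the Cauchy-Schwarz inequality.
\<close>

lemma Re_cdot_near_real:
  fixes a :: "real^'k"
  assumes "norm (w - cvec a) \<le> x * norm a" "0 \<le> x"
  shows "(norm a)\<^sup>2 * (1 - 2 * x - x\<^sup>2) \<le> Re (cdot w)"
proof -
  define d where "d = w - cvec a"
  define b where "b = cvec a"
  have w: "w = b + d" by (simp add: d_def b_def)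
  have b: "norm b = norm a" by (simp add: b_def)
  have d: "norm d \<le> x * norm a" using assms by (simp add: d_def)
  have "cdot w = cdot b + (2 * (\<Sum>k\<in>UNIV. b $ k * d $ k) + (\<Sum>k\<in>UNIV. d $ k * d $ k))"
    by (simp add: w cdot_def sum.distrib sum_distrib_left algebra_simps)
  then have "Re (cdot w) \<ge> Re (cdot b) - norm (2 * (\<Sum>k\<in>UNIV. b $ k * d $ k) + (\<Sum>k\<in>UNIV. d $ k * d $ k))"
    using abs_Re_le_cmod[of "2 * (\<Sum>k\<in>UNIV. b $ k * d $ k) + (\<Sum>k\<in>UNIV. d $ k * d $ k)"] by simp
  moreover have "norm (2 * (\<Sum>k\<in>UNIV. b $ k * d $ k) + (\<Sum>k\<in>UNIV. d $ k * d $ k))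
      \<le> 2 * (norm b * norm d) + norm d * norm d"
    by (rule norm_triangle_le)
       (use norm_sum_mult_le[of b d] norm_sum_mult_le[of d d] in \<open>simp add: norm_mult\<close>)
  moreover have "\<dots> \<le> 2 * (norm a * (x * norm a)) + (x * norm a) * (x * norm a)"
    unfolding b using d assms by (intro add_mono mult_left_mono mult_mono) auto
  ultimately show ?thesis
    by (simp add: b_def cdot_cvec power2_eq_square algebra_simps)
qed

lemma norm_pull: "norm (pull w) = norm w / sqrt (norm (cdot w)) ^ 3"
  by (simp add: pull_def norm_vector_smult norm_divide norm_power)

lemma norm_pull_near_real:
  fixes a :: "real^'k"
  assumes w: "norm (w - cvec a) \<le> x * norm a" and x: "0 \<le> x" "x < sqrt 2 - 1" and a: "a \<noteq> 0"
  shows "norm (pull w) \<le> growth x / (norm a)\<^sup>2"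
proof -
  define y where "y = 1 - 2 * x - x\<^sup>2"
  have y: "0 < y" using shrink_pos[OF x] by (simp add: y_def)
  have "(norm a)\<^sup>2 * y \<le> norm (cdot w)"
    using Re_cdot_near_real[OF w x(1)] complex_Re_le_cmod[of "cdot w"] by (simp add: y_def)
  then have "sqrt ((norm a)\<^sup>2 * y) \<le> sqrt (norm (cdot w))"
    by (rule real_sqrt_le_mono)
  then have low: "norm a * sqrt y \<le> sqrt (norm (cdot w))"
    by (simp add: real_sqrt_mult)
  have "norm w \<le> norm (cvec a) + norm (w - cvec a)" by (rule norm_triangle_sub)
  also have "\<dots> \<le> (1 + x) * norm a" using w by (simp add: algebra_simps)
  (* The numerator of the growth function comes from the norm of w, its denominator from w . w. *)
  finally have "norm w / sqrt (norm (cdot w)) ^ 3 \<le> ((1 + x) * norm a) / (norm a * sqrt y) ^ 3"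
    using low y a x by (intro frac_le power_mono) auto
  also have "\<dots> = growth x / (norm a)\<^sup>2"
  proof -
    have "((1 + x) * n) / (n * r) ^ 3 = (1 + x) / r ^ 3 / n\<^sup>2" if "n \<noteq> 0" for n r :: real
      using that by (cases "r = 0") (simp_all add: power2_eq_square power3_eq_cube)
    from this[of "norm a" "sqrt y"] a show ?thesis by (simp add: growth_def y_def)
  qed
  finally show ?thesis by (simp add: norm_pull)
qed

lemma Re_csqrt_ge:
  assumes "0 \<le> d" "d\<^sup>2 \<le> Re z"
  shows "d \<le> Re (csqrt z)"
  using assms complex_Re_le_cmod[of z] by (auto intro!: real_le_rsqrt)

text \<open>
  A direct algebraic estimate avoids derivatives and any convexity of the domain. With the roots $p$ and
  $r$ of $u \cdot u$ and $w \cdot w$, the difference $p - r$ is controlled by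
  $(p - r)(p + r) = (u - w) \cdot (u + w)$, where $|p + r| \ge 2d$ because both roots have real part at
  least $d$.
\<close>

lemma pull_lipschitz:
  fixes u w :: "complex^'k"
  assumes d: "0 < d" and u: "d\<^sup>2 \<le> Re (cdot u)" "norm u \<le> D" and w: "d\<^sup>2 \<le> Re (cdot w)" "norm w \<le> D"
  shows "norm (pull u - pull w) \<le> (1 / d ^ 3 + 3 * D\<^sup>2 / d ^ 5) * norm (u - w)"
proof -
  define p where "p = csqrt (cdot u)"
  define r where "r = csqrt (cdot w)"
  have D: "0 \<le> D" using u(2) norm_ge_zero order_trans by blast
  have Rp: "d \<le> Re p" "d \<le> Re r"
    unfolding p_def r_def using d u w by (auto intro!: Re_csqrt_ge simp del: csqrt.simps)
  then have np: "d \<le> norm p" "d \<le> norm r" 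
    using complex_Re_le_cmod order_trans by blast+
  have p0: "p \<noteq> 0" "r \<noteq> 0" using np d by auto
  have npr: "2 * d \<le> norm (p + r)"
    using Rp complex_Re_le_cmod[of "p + r"] by simp
  have "(r - p) * (p + r) = cdot w - cdot u"
    by (simp add: p_def r_def algebra_simps power2_eq_square[symmetric] del: csqrt.simps)
  also have "\<dots> = (\<Sum>k\<in>UNIV. (w - u) $ k * (w + u) $ k)"
    by (simp add: cdot_def algebra_simps sum_subtractf sum.distrib)
  finally have "norm (r - p) * norm (p + r) \<le> norm (w - u) * norm (w + u)"
    using norm_sum_mult_le[of "w - u" "w + u"] by (metis norm_mult)
  moreover have "norm (r - p) * (2 * d) \<le> norm (r - p) * norm (p + r)"
    using npr by (intro mult_left_mono) auto
  moreover have "norm (w - u) * norm (w + u) \<le> norm (w - u) * (2 * D)"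
    using norm_triangle_ineq[of w u] u w by (intro mult_left_mono) auto
  ultimately have "norm (r - p) * (2 * d) \<le> norm (w - u) * (2 * D)" by linarith
  then have rp: "norm (r - p) \<le> (D / d) * norm (u - w)"
    using d by (simp add: field_simps norm_minus_commute)
  have "1 / p ^ 3 - 1 / r ^ 3 = (r - p) * (1 / (p * r ^ 3) + 1 / (p ^ 2 * r ^ 2) + 1 / (p ^ 3 * r))"
    using p0 by (simp add: field_simps power2_eq_square power3_eq_cube)
  moreover have "norm (1 / (p * r ^ 3) + 1 / (p ^ 2 * r ^ 2) + 1 / (p ^ 3 * r)) \<le> 1 / d ^ 4 + 1 / d ^ 4 + 1 / d ^ 4"
  proof -
    have "1 / (norm p * norm r ^ 3) \<le> 1 / (d * d ^ 3)" "1 / (norm p ^ 2 * norm r ^ 2) \<le> 1 / (d ^ 2 * d ^ 2)"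
      "1 / (norm p ^ 3 * norm r) \<le> 1 / (d ^ 3 * d)"
      using d np by (intro frac_le mult_mono power_mono; simp)+
    then show ?thesis
      by (intro norm_triangle_le add_mono)
         (simp_all add: norm_divide norm_mult norm_power power4_eq_xxxx power2_eq_square power3_eq_cube)
  qed
  ultimately have inv: "norm (1 / p ^ 3 - 1 / r ^ 3) \<le> ((D / d) * norm (u - w)) * (3 / d ^ 4)"
    using rp D d by (simp only: norm_mult) (intro mult_mono, auto)
  have "pull u - pull w = (1 / p ^ 3) *s (u - w) + (1 / p ^ 3 - 1 / r ^ 3) *s w"
    by (simp add: pull_def p_def r_def vec_eq_iff algebra_simps del: csqrt.simps)
  also have "norm \<dots> \<le> norm (1 / p ^ 3) * norm (u - w) + norm (1 / p ^ 3 - 1 / r ^ 3) * norm w"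
    by (rule norm_triangle_le) (simp only: norm_vector_smult order_refl)
  also have "\<dots> \<le> (1 / d ^ 3) * norm (u - w) + (((D / d) * norm (u - w)) * (3 / d ^ 4)) * D"
    using inv w np d D
    by (intro add_mono mult_mono) (auto simp: norm_divide norm_power intro!: frac_le power_mono)
  also have "\<dots> = (1 / d ^ 3 + 3 * D\<^sup>2 / d ^ 5) * norm (u - w)"
    using d by (simp add: field_simps power2_eq_square power3_eq_cube eval_nat_numeral)
  finally show ?thesis .
qed

definition separated :: "real \<Rightarrow> real \<Rightarrow> complex^3^'n \<Rightarrow> bool" where
  "separated d D Q \<longleftrightarrow>
     (\<forall>i j. i \<noteq> j \<longrightarrow> d\<^sup>2 \<le> Re (cdot (Q $ j - Q $ i)) \<and> norm (Q $ j - Q $ i) \<le> D)"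

lemma cforce_lipschitz:
  fixes m :: "real^'n"
  assumes "0 < d"
  obtains L where "0 < L" 
    "\<And>P Q. separated d D P \<Longrightarrow> separated d D Q \<Longrightarrow> norm (cforce G m P - cforce G m Q) \<le> L * norm (P - Q)"
proof -
  define c where "c = 1 / d ^ 3 + 3 * D\<^sup>2 / d ^ 5"
  have c: "0 \<le> c" using assms by (simp add: c_def)
  define L where "L = (\<Sum>i\<in>(UNIV::'n set). \<Sum>j\<in>UNIV - {i}. \<bar>G * m $ j\<bar> * (c * 2))"
  have "norm (cforce G m P - cforce G m Q) \<le> L * norm (P - Q)"
    if P: "separated d D P" and Q: "separated d D Q" for P Q
  proof -
    have "norm (cforce G m P - cforce G m Q) \<le> (\<Sum>i\<in>UNIV. norm ((cforce G m P - cforce G m Q) $ i))"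
      unfolding norm_vec_def[of "cforce G m P - cforce G m Q"] by (rule L2_set_le_sum) simp
    also have "\<dots> \<le> (\<Sum>i\<in>(UNIV::'n set). \<Sum>j\<in>UNIV - {i}. \<bar>G * m $ j\<bar> * (c * (2 * norm (P - Q))))"
    proof (intro sum_mono)
      fix i
      have "(cforce G m P - cforce G m Q) $ i
        = (\<Sum>j\<in>UNIV - {i}. of_real (G * m $ j) *s (pull (P $ j - P $ i) - pull (Q $ j - Q $ i)))"
        by (simp add: cforce_def sum_subtractf[symmetric] vector_sub_rdistrib vec_eq_iff algebra_simps)
      also have "norm \<dots> \<le> (\<Sum>j\<in>UNIV - {i}. \<bar>G * m $ j\<bar> * (c * (2 * norm (P - Q))))"
      proof (intro order_trans[OF norm_sum] sum_mono)
        fix j assume j: "j \<in> UNIV - {i}"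
        have "norm (pull (P $ j - P $ i) - pull (Q $ j - Q $ i))
            \<le> c * norm ((P $ j - P $ i) - (Q $ j - Q $ i))"
          unfolding c_def using P Q j by (intro pull_lipschitz assms) (auto simp: separated_def)
        also have "(P $ j - P $ i) - (Q $ j - Q $ i) = (P - Q) $ j - (P - Q) $ i" by simp
        also have "c * norm ((P - Q) $ j - (P - Q) $ i) \<le> c * (2 * norm (P - Q))"
          using norm_triangle_ineq4[of "(P - Q) $ j" "(P - Q) $ i"]
            Finite_Cartesian_Product.norm_nth_le[of "P - Q" i] Finite_Cartesian_Product.norm_nth_le[of "P - Q" j] c
          by (intro mult_left_mono) linarith+
        finally show "norm (of_real (G * m $ j) *s (pull (P $ j - P $ i) - pull (Q $ j - Q $ i)))
          \<le> \<bar>G * m $ j\<bar> * (c * (2 * norm (P - Q)))"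
          by (simp only: norm_vector_smult norm_of_real) (intro mult_left_mono, auto)
      qed
      finally show "norm ((cforce G m P - cforce G m Q) $ i)
        \<le> (\<Sum>j\<in>UNIV - {i}. \<bar>G * m $ j\<bar> * (c * (2 * norm (P - Q))))" .
    qed
    also have "\<dots> = L * norm (P - Q)"
      unfolding L_def by (simp add: sum_distrib_right mult.assoc)
    finally show ?thesis .
  qed
  then have "norm (cforce G m P - cforce G m Q) \<le> (\<bar>L\<bar> + 1) * norm (P - Q)"
    if "separated d D P" "separated d D Q" for P Q
    using that by (intro order_trans[OF _ mult_right_mono[of L "\<bar>L\<bar> + 1"]]) auto
  then show thesis by (intro that[of "\<bar>L\<bar> + 1"]) auto
qed

lemma cvec_nbody_accel:
  fixes q :: "real^3^'n"
  assumes "\<And>i j. i \<noteq> j \<Longrightarrow> q $ i \<noteq> q $ j"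
  shows "cvec (nbody_accel G m q i) = cforce G m (cconf q) $ i"
proof -
  have "csqrt (cdot (cvec (q $ j - q $ i))) = of_real (norm (q $ j - q $ i))" for i j
    unfolding cdot_cvec by (subst csqrt_of_real) auto
  then show ?thesis
    by (simp add: vec_eq_iff cforce_def nbody_accel_def cconf_def cvec_diff[symmetric] pull_def)
       (simp add: cvec_def norm_minus_commute)
qed

lemma cforce_holomorphic:
  assumes hol: "\<And>i k. (\<lambda>z. Q z $ i $ k) holomorphic_on S"
    and pos: "\<And>z i j. z \<in> S \<Longrightarrow> i \<noteq> j \<Longrightarrow> 0 < Re (cdot (Q z $ j - Q z $ i))"
  shows "(\<lambda>z. cforce G m (Q z) $ i $ k) holomorphic_on S"
proof -
  have "(\<lambda>z. cforce G m (Q z) $ i $ k) = (\<lambda>z. \<Sum>j\<in>UNIV - {i}. of_real (G * m $ j) *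
      (1 / csqrt (\<Sum>l\<in>UNIV. (Q z $ j $ l - Q z $ i $ l) * (Q z $ j $ l - Q z $ i $ l)) ^ 3 *
        (Q z $ j $ k - Q z $ i $ k)))"
    by (simp add: cforce_def pull_def cdot_def right_diff_distrib diff_divide_distrib)
  moreover have "(\<lambda>z. \<Sum>j\<in>UNIV - {i}. of_real (G * m $ j) *
      (1 / csqrt (\<Sum>l\<in>UNIV. (Q z $ j $ l - Q z $ i $ l) * (Q z $ j $ l - Q z $ i $ l)) ^ 3 *
        (Q z $ j $ k - Q z $ i $ k))) holomorphic_on S"
  proof (intro holomorphic_intros hol)
    fix z j assume "z \<in> S" "j \<in> UNIV - {i}"
    then have *: "0 < Re (\<Sum>l\<in>UNIV. (Q z $ j $ l - Q z $ i $ l) * (Q z $ j $ l - Q z $ i $ l))"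
      using pos[of z i j] by (simp add: cdot_def)
    then show "(\<Sum>l\<in>UNIV. (Q z $ j $ l - Q z $ i $ l) * (Q z $ j $ l - Q z $ i $ l)) \<notin> \<real>\<^sub>\<le>\<^sub>0"
      by (auto simp: complex_nonpos_Reals_iff)
    show "csqrt (\<Sum>l\<in>UNIV. (Q z $ j $ l - Q z $ i $ l) * (Q z $ j $ l - Q z $ i $ l)) ^ 3 \<noteq> 0"
    proof -
      have "w \<noteq> 0" if "0 < Re w" for w using that by auto
      then have "(\<Sum>l\<in>UNIV. (Q z $ j $ l - Q z $ i $ l) * (Q z $ j $ l - Q z $ i $ l)) \<noteq> 0"
        using * .
      then show ?thesis by (simp del: csqrt.simps)
    qed
  qed
  ultimately show ?thesis by simp
qed

definition vcnj :: "complex^'k^'n \<Rightarrow> complex^'k^'n" where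
  "vcnj Q = (\<chi> i. \<chi> k. cnj (Q $ i $ k))"

lemma cdot_vcnj: "cdot (vcnj Q $ j - vcnj Q $ i) = cnj (cdot (Q $ j - Q $ i))"
  by (simp add: cdot_def vcnj_def)

lemma cforce_vcnj:
  assumes "\<And>i j. i \<noteq> j \<Longrightarrow> 0 < Re (cdot (Q $ j - Q $ i))"
  shows "cforce G m (vcnj Q) = vcnj (cforce G m Q)"
proof -
  have "csqrt (cnj (cdot (Q $ j - Q $ i))) = cnj (csqrt (cdot (Q $ j - Q $ i)))" if "i \<noteq> j" for i j
    using assms[OF that] by (subst cnj_csqrt) (auto simp: complex_nonpos_Reals_iff simp del: csqrt.simps)
  then show ?thesis
    by (simp add: vec_eq_iff cforce_def pull_def cdot_vcnj)
       (auto simp: vcnj_def intro!: sum.cong)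
qed

text \<open>
  The pairwise differences, and not the positions themselves, are compared with their initial values:
  the force depends on nothing else, and the common drift of the bodies would spoil the radius.
\<close>

definition spread_within :: "real^3^'n \<Rightarrow> real \<Rightarrow> complex^3^'n \<Rightarrow> bool" where
  "spread_within q0 x Q \<longleftrightarrow>
     (\<forall>i j. norm ((Q $ j - Q $ i) - cvec (q0 $ j - q0 $ i)) \<le> x * norm (q0 $ j - q0 $ i))"

lemma nbody_M_le_nu:
  fixes q0 :: "real^3^'n"
  assumes "i \<noteq> j" "\<And>i j. i \<noteq> j \<Longrightarrow> q0 $ i \<noteq> q0 $ j"
  shows "nbody_M G m q0 i j \<le> nbody_nu G m q0 * norm (q0 $ i - q0 $ j)"
proof -
  have fin: "finite {nbody_M G m q0 i j / norm (q0 $ i - q0 $ j) | i j. i \<noteq> j}"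
    by (rule finite_subset[of _ "(\<lambda>(i,j). nbody_M G m q0 i j / norm (q0 $ i - q0 $ j)) ` UNIV"]) auto
  have "nbody_M G m q0 i j / norm (q0 $ i - q0 $ j) \<le> nbody_nu G m q0"
    unfolding nbody_nu_def by (rule Max_ge[OF fin]) (use assms(1) in auto)
  then show ?thesis using assms by (simp add: field_simps)
qed

lemma velocity_le_mu:
  fixes q0 v0 :: "real^3^'n"
  assumes "i \<noteq> j" "\<And>i j. i \<noteq> j \<Longrightarrow> q0 $ i \<noteq> q0 $ j"
  shows "norm (v0 $ i - v0 $ j) \<le> nbody_mu q0 v0 * norm (q0 $ i - q0 $ j)"
proof -
  have fin: "finite {norm (v0 $ i - v0 $ j) / norm (q0 $ i - q0 $ j) | i j. i \<noteq> j}"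
    by (rule finite_subset[of _ "(\<lambda>(i,j). norm (v0 $ i - v0 $ j) / norm (q0 $ i - q0 $ j)) ` UNIV"]) auto
  have "norm (v0 $ i - v0 $ j) / norm (q0 $ i - q0 $ j) \<le> nbody_mu q0 v0"
    unfolding nbody_mu_def by (rule Max_ge[OF fin]) (use assms(1) in auto)
  then show ?thesis using assms by (simp add: field_simps)
qed

text \<open>
  This is where $\nu_0$ comes from: each of the two accelerations is bounded by $K_i f(x)$ or
  $K_j f(x)$, and the sum $M_{ij}$ is at most $\nu_0 \|q_i^0 - q_j^0\|$.
\<close>

lemma cforce_pair_bound:
  fixes q0 :: "real^3^'n"
  assumes G: "0 < G" and m: "\<And>i. 0 < m $ i" and q0: "\<And>i j. i \<noteq> j \<Longrightarrow> q0 $ i \<noteq> q0 $ j"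
    and x: "0 \<le> x" "x < sqrt 2 - 1" and Q: "spread_within q0 x Q"
  shows "norm (cforce G m Q $ i - cforce G m Q $ j)
    \<le> nbody_nu G m q0 * growth x * norm (q0 $ i - q0 $ j)"
proof (cases "i = j")
  case False
  have g: "0 \<le> growth x" using x shrink_pos[OF x] by (simp add: growth_def)
  have one: "norm (cforce G m Q $ i) \<le> nbody_K G m q0 i * growth x" for i
  proof -
    have "norm (cforce G m Q $ i) \<le> (\<Sum>j\<in>UNIV - {i}. G * m $ j / (norm (q0 $ i - q0 $ j))\<^sup>2 * growth x)"
      unfolding cforce_def vec_lambda_beta
    proof (intro order_trans[OF norm_sum] sum_mono)
      fix j assume j: "j \<in> UNIV - {i}"
      have "norm (pull (Q $ j - Q $ i)) \<le> growth x / (norm (q0 $ j - q0 $ i))\<^sup>2"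
        by (rule norm_pull_near_real[OF _ x]) (use Q q0[of j i] j in \<open>auto simp: spread_within_def\<close>)
      then have "(G * m $ j) * norm (pull (Q $ j - Q $ i)) \<le> (G * m $ j) * (growth x / (norm (q0 $ j - q0 $ i))\<^sup>2)"
        using G m[of j] by (intro mult_left_mono) auto
      then show "norm (of_real (G * m $ j) *s pull (Q $ j - Q $ i)) \<le> G * m $ j / (norm (q0 $ i - q0 $ j))\<^sup>2 * growth x"
        using G m[of j] by (simp add: norm_vector_smult norm_minus_commute norm_mult)
    qed
    then show ?thesis by (simp add: nbody_K_def sum_distrib_right)
  qed
  have "norm (cforce G m Q $ i - cforce G m Q $ j) \<le> nbody_M G m q0 i j * growth x"
    using one[of i] one[of j] norm_triangle_ineq4[of "cforce G m Q $ i" "cforce G m Q $ j"]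
    by (simp add: nbody_M_def distrib_right)
  also have "\<dots> \<le> (nbody_nu G m q0 * norm (q0 $ i - q0 $ j)) * growth x"
    using nbody_M_le_nu[OF False q0] g by (intro mult_right_mono) auto
  finally show ?thesis by (simp add: mult_ac)
qed simp

text \<open>
  Uniform constants for all pairs: for the lower bound, every small enough \<open>d\<close> works for each single
  pair, hence for the finitely many pairs at once.
\<close>

lemma spread_within_separated:
  fixes q0 :: "real^3^'n"
  assumes q0: "\<And>i j. i \<noteq> j \<Longrightarrow> q0 $ i \<noteq> q0 $ j" and s: "0 \<le> s" "s < sqrt 2 - 1"
  obtains d D where "0 < d" "\<And>Q. spread_within q0 s Q \<Longrightarrow> separated d D Q"
proof -
  have ev: "\<forall>\<^sub>F d in at_right 0. \<forall>i j. i \<noteq> j \<longrightarrow> d \<le> norm (q0 $ j - q0 $ i) * sqrt (1 - 2 * s - s\<^sup>2)"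
  proof (intro eventually_all_finite)
    fix i j
    show "\<forall>\<^sub>F d in at_right 0. i \<noteq> j \<longrightarrow> d \<le> norm (q0 $ j - q0 $ i) * sqrt (1 - 2 * s - s\<^sup>2)"
    proof (cases "i = j")
      case False
      then have "0 < norm (q0 $ j - q0 $ i) * sqrt (1 - 2 * s - s\<^sup>2)"
        using q0[of j i] shrink_pos[OF s] by simp
      from eventually_at_right_real[OF this] show ?thesis by eventually_elim auto
    qed simp
  qed
  have "\<forall>\<^sub>F d in at_right (0::real). 0 < d" by (simp add: eventually_at_right_less)
  from eventually_happens'[OF trivial_limit_at_right_real eventually_conj[OF this ev]]
  obtain d where d: "0 < d" and dle: "\<And>i j. i \<noteq> j \<Longrightarrow> d \<le> norm (q0 $ j - q0 $ i) * sqrt (1 - 2 * s - s\<^sup>2)"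
    by blast
  define D where "D = (\<Sum>i\<in>UNIV. \<Sum>j\<in>UNIV. (1 + s) * norm (q0 $ j - q0 $ i))"
  have "separated d D Q" if Q: "spread_within q0 s Q" for Q
    unfolding separated_def
  proof (intro allI impI conjI)
    fix i j :: 'n assume ij: "i \<noteq> j"
    have w: "norm ((Q $ j - Q $ i) - cvec (q0 $ j - q0 $ i)) \<le> s * norm (q0 $ j - q0 $ i)"
      using Q by (simp add: spread_within_def)
    have "d\<^sup>2 \<le> (norm (q0 $ j - q0 $ i) * sqrt (1 - 2 * s - s\<^sup>2))\<^sup>2"
      using d dle[OF ij] by (intro power_mono) auto
    also have "\<dots> = (norm (q0 $ j - q0 $ i))\<^sup>2 * (1 - 2 * s - s\<^sup>2)"
      using shrink_pos[OF s] by (simp add: power_mult_distrib)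
    also have "\<dots> \<le> Re (cdot (Q $ j - Q $ i))" by (rule Re_cdot_near_real[OF w s(1)])
    finally show "d\<^sup>2 \<le> Re (cdot (Q $ j - Q $ i))" .
    have "norm (Q $ j - Q $ i) \<le> norm (cvec (q0 $ j - q0 $ i)) + s * norm (q0 $ j - q0 $ i)"
      using norm_triangle_sub[of "Q $ j - Q $ i" "cvec (q0 $ j - q0 $ i)"] w by linarith
    also have "\<dots> = (1 + s) * norm (q0 $ j - q0 $ i)" by (simp add: algebra_simps)
    also have "\<dots> \<le> (\<Sum>j\<in>UNIV. (1 + s) * norm (q0 $ j - q0 $ i))"
      by (rule member_le_sum) (use s in auto)
    also have "\<dots> \<le> D" unfolding D_def
      by (rule member_le_sum[where f = "\<lambda>i. \<Sum>j\<in>UNIV. (1 + s) * norm (q0 $ j - q0 $ i)"])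
         (use s in \<open>auto intro!: sum_nonneg\<close>)
    finally show "norm (Q $ j - Q $ i) \<le> D" .
  qed
  with d show thesis by (rule that)
qed

section \<open>Primitives and limits of vector-valued holomorphic functions\<close>

lemma cderiv_on_diff:
  assumes "cderiv_on S P V" "cderiv_on S Q W"
  shows "cderiv_on S (\<lambda>z. P z - Q z) (\<lambda>z. V z - W z)"
  using assms unfolding cderiv_on_def by (auto intro!: DERIV_diff)

lemma cderiv_on_primitive:
  fixes W :: "complex \<Rightarrow> complex^'k^'n"
  assumes "\<And>i k. (\<lambda>z. W z $ i $ k) holomorphic_on ball 0 R"
  obtains P where "cderiv_on (ball 0 R) P W" "P 0 = c"
proof -
  have "\<exists>g. \<forall>z\<in>ball 0 R. (g has_field_derivative W z $ i $ k) (at z)" for i k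
    using holomorphic_convex_primitive'[OF convex_ball open_ball assms[of i k]]
    by (metis at_within_open open_ball)
  then obtain g where g: "\<And>i k z. z \<in> ball 0 R \<Longrightarrow> (g i k has_field_derivative W z $ i $ k) (at z)"
    by metis
  show thesis
  proof (rule that)
    show "cderiv_on (ball 0 R) (\<lambda>z. \<chi> i. \<chi> k. g i k z - g i k 0 + c $ i $ k) W"
      unfolding cderiv_on_def by (auto intro!: derivative_eq_intros g)
  qed (simp add: vec_eq_iff)
qed

lemma geometric_steps_uniform_limit:
  fixes f :: "nat \<Rightarrow> complex \<Rightarrow> 'b::banach"
  assumes "\<And>\<rho>. 0 \<le> \<rho> \<Longrightarrow> \<rho> < R \<Longrightarrow> \<exists>C. \<forall>n z. norm z \<le> \<rho> \<longrightarrow> norm (f (Suc n) z - f n z) \<le> C / 2 ^ n"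
  obtains g where "\<And>\<rho>. 0 \<le> \<rho> \<Longrightarrow> \<rho> < R \<Longrightarrow> uniform_limit (cball 0 \<rho>) f g sequentially"
proof (rule that)
  fix \<rho> :: real assume "0 \<le> \<rho>" "\<rho> < R"
  from assms[OF this] obtain C
    where C: "\<And>n z. norm z \<le> \<rho> \<Longrightarrow> norm (f (Suc n) z - f n z) \<le> C / 2 ^ n" by blast
  have "summable (\<lambda>n. C * (1/2) ^ n)" by (intro summable_mult summable_geometric) simp
  then have "summable (\<lambda>n. C / 2 ^ n)" by (simp add: power_one_over)
  then have "uniform_limit (cball 0 \<rho>) (\<lambda>n z. \<Sum>i<n. f (Suc i) z - f i z)
      (\<lambda>z. \<Sum>i. f (Suc i) z - f i z) sequentially"
    by (intro Weierstrass_m_test[where M = "\<lambda>n. C / 2 ^ n"]) (auto intro: C)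
  then have "uniform_limit (cball 0 \<rho>) (\<lambda>n z. f 0 z + (\<Sum>i<n. f (Suc i) z - f i z))
      (\<lambda>z. f 0 z + (\<Sum>i. f (Suc i) z - f i z)) sequentially"
    by (intro uniform_limit_intros)
  moreover have "f 0 z + (\<Sum>i<n. f (Suc i) z - f i z) = f n z" for n z
    using sum_lessThan_telescope[of "\<lambda>n. f n z" n] by simp
  ultimately show "uniform_limit (cball 0 \<rho>) f (\<lambda>z. f 0 z + (\<Sum>i. f (Suc i) z - f i z)) sequentially"
    by simp
qed

lemma cderiv_on_uniform_limit:
  fixes P :: "nat \<Rightarrow> complex \<Rightarrow> complex^'k^'n"
  assumes lim: "\<And>\<rho>. 0 \<le> \<rho> \<Longrightarrow> \<rho> < R \<Longrightarrow> uniform_limit (cball 0 \<rho>) P Q sequentially"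
    and der: "\<And>n. cderiv_on (ball 0 R) (P n) (W n)"
    and W: "\<And>z. z \<in> ball 0 R \<Longrightarrow> (\<lambda>n. W n z) \<longlonglongrightarrow> V z"
  shows "cderiv_on (ball 0 R) Q V"
  unfolding cderiv_on_def
proof (intro ballI allI)
  fix z :: complex and i k assume z: "z \<in> ball 0 R"
  have "\<exists>g'. \<forall>x\<in>ball 0 R. ((\<lambda>w. Q w $ i $ k) has_field_derivative g' x) (at x) \<and>
      ((\<lambda>n. W n x $ i $ k) \<longlongrightarrow> g' x) sequentially"
  proof (rule has_complex_derivative_uniform_sequence)
    show "((\<lambda>w. P n w $ i $ k) has_field_derivative W n x $ i $ k) (at x)" if "x \<in> ball 0 R" for n x
      using der that by (auto simp: cderiv_on_def)
    fix x :: complex assume x: "x \<in> ball 0 R"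
    define d where "d = (R - norm x) / 2"
    have d: "0 < d" using x by (simp add: d_def)
    have sub: "cball x d \<subseteq> cball 0 (norm x + d)"
      by (auto simp: cball_subset_cball_iff)
    have "norm x + d < R" using d by (simp add: d_def field_simps)
    then have "uniform_limit (cball x d) P Q sequentially"
      using d by (intro uniform_limit_on_subset[OF lim sub]) auto
    then have "uniform_limit (cball x d) (\<lambda>n w. P n w $ i $ k) (\<lambda>w. Q w $ i $ k) sequentially"
      by (intro bounded_linear.uniform_limit[OF bounded_linear_vec_nth])
    moreover have "cball x d \<subseteq> ball 0 R"
      using sub \<open>norm x + d < R\<close> by (auto simp: subset_iff)
    ultimately show "\<exists>d>0. cball x d \<subseteq> ball 0 R \<and>
        uniform_limit (cball x d) (\<lambda>n w. P n w $ i $ k) (\<lambda>w. Q w $ i $ k) sequentially"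
      using d by blast
  qed simp
  then obtain g' where g': "((\<lambda>w. Q w $ i $ k) has_field_derivative g') (at z)"
      "(\<lambda>n. W n z $ i $ k) \<longlonglongrightarrow> g'"
    using z by blast
  moreover have "(\<lambda>n. W n z $ i $ k) \<longlonglongrightarrow> V z $ i $ k"
    by (intro tendsto_vec_nth W z)
  ultimately show "((\<lambda>w. Q w $ i $ k) has_field_derivative V z $ i $ k) (at z)"
    using LIMSEQ_unique by blast
qed

section \<open>Picard iteration on the disk\<close>

text \<open>
  The Picard iteration needs of the radius only that the comparison equation has a majorant up to each
  smaller time.
\<close>

locale majorized_nbody =
  fixes G :: real and m :: "real^'n" and q0 v0 :: "real^3^'n" and R :: real
  assumes G: "0 < G" and m: "\<And>i. 0 < m $ i" and distinct: "\<And>i j. i \<noteq> j \<Longrightarrow> q0 $ i \<noteq> q0 $ j"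
    and R: "0 < R" and nu: "0 < nbody_nu G m q0"
    and majorants: "\<And>\<rho>. 0 \<le> \<rho> \<Longrightarrow> \<rho> < R \<Longrightarrow>
      \<exists>s \<sigma> \<sigma>'. majorant (nbody_mu q0 v0) (nbody_nu G m q0) \<rho> s \<sigma> \<sigma>'"
begin

abbreviation "maj \<equiv> majorant (nbody_mu q0 v0) (nbody_nu G m q0)"

text \<open>
  The invariant of the iteration refers to all majorants at once, because each of them reaches only up
  to some $\rho < R$ while the iterates live on the whole disk.
\<close>

definition admissible :: "(complex \<Rightarrow> complex^3^'n) \<Rightarrow> bool" where
  "admissible Q \<longleftrightarrow> (\<forall>\<rho> s \<sigma> \<sigma>'. \<rho> < R \<longrightarrow> maj \<rho> s \<sigma> \<sigma>' \<longrightarrow>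
     (\<forall>z. norm z \<le> \<rho> \<longrightarrow> spread_within q0 (\<sigma> (norm z)) (Q z)))"

lemma spread_within_mono: "spread_within q0 x Q \<Longrightarrow> x \<le> y \<Longrightarrow> spread_within q0 y Q"
  unfolding spread_within_def by (meson mult_right_mono norm_ge_zero order_trans)

lemma admissible_uniform:
  assumes "0 \<le> \<rho>" "\<rho> < R"
  obtains s where "0 \<le> s" "s < sqrt 2 - 1"
    "\<And>Q z. admissible Q \<Longrightarrow> norm z \<le> \<rho> \<Longrightarrow> spread_within q0 s (Q z)"
proof -
  obtain s \<sigma> \<sigma>' where M: "maj \<rho> s \<sigma> \<sigma>'" using majorants[OF assms] by blast
  have \<sigma>: "0 \<le> \<sigma> t \<and> \<sigma> t \<le> s" if "0 \<le> t" "t \<le> \<rho>" for t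
    using M that unfolding majorant_def by simp
  have "spread_within q0 s (Q z)" if "admissible Q" "norm z \<le> \<rho>" for Q z
  proof (rule spread_within_mono)
    show "spread_within q0 (\<sigma> (norm z)) (Q z)"
      using that M assms(2) unfolding admissible_def by blast
    show "\<sigma> (norm z) \<le> s" using \<sigma>[of "norm z"] that by simp
  qed
  moreover have "0 \<le> s" using \<sigma>[of 0] assms(1) by simp
  moreover have "s < sqrt 2 - 1" using M by (simp add: majorant_def)
  ultimately show thesis by (intro that)
qed

lemma admissible_Re_pos:
  assumes "admissible Q" "z \<in> ball 0 R" "i \<noteq> j"
  shows "0 < Re (cdot (Q z $ j - Q z $ i))"
proof -
  obtain s where s: "0 \<le> s" "s < sqrt 2 - 1" "spread_within q0 s (Q z)"
    using admissible_uniform[of "norm z"] assms by (metis mem_ball_0 norm_ge_zero order_refl)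
  obtain d D where d: "0 < d" and "separated d D (Q z)"
    using spread_within_separated[OF distinct s(1,2)] s(3) by metis
  then have "d\<^sup>2 \<le> Re (cdot (Q z $ j - Q z $ i))" using assms by (simp add: separated_def)
  then show ?thesis using d zero_less_power[of d 2] by linarith
qed

text \<open>
  Two integrations along rays: the bound on \<open>W\<close> by $\nu_0 f(\sigma) = \sigma''$ gives a bound on \<open>V\<close> by
  $\sigma'$, which in turn gives a bound on \<open>Q\<close> by $\sigma$.
\<close>

lemma majorized_admissible:
  assumes QV: "cderiv_on (ball 0 R) Q V" and VW: "cderiv_on (ball 0 R) V W"
    and Q0: "Q 0 = cconf q0" and V0: "V 0 = cconf v0"
    and bound: "\<And>\<rho> s \<sigma> \<sigma>' z i j. \<rho> < R \<Longrightarrow> maj \<rho> s \<sigma> \<sigma>' \<Longrightarrow> norm z \<le> \<rho> \<Longrightarrow>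
      norm (W z $ i - W z $ j) \<le> nbody_nu G m q0 * growth (\<sigma> (norm z)) * norm (q0 $ i - q0 $ j)"
  shows "admissible Q"
  unfolding admissible_def spread_within_def
proof (intro allI impI)
  fix \<rho> s \<sigma> \<sigma>' and z :: complex and j i
  assume \<rho>: "\<rho> < R" and M: "maj \<rho> s \<sigma> \<sigma>'" and z: "norm z \<le> \<rho>"
  define N where "N = norm (q0 $ i - q0 $ j)"
  have N: "0 \<le> N" by (simp add: N_def)
  define p where "p = (\<lambda>x :: complex^3^'n. x $ i - x $ j)"
  have p: "bounded_linear p" unfolding p_def by (intro bounded_linear_sub bounded_linear_vec_nth)
  have unit: "norm (p (cscale e x)) = norm (p x)" if "norm e = 1" for e x
  proof -
    have "p (cscale e x) = e *s p x"
      by (simp add: p_def cscale_def vec_eq_iff algebra_simps)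
    then show ?thesis using that by (simp add: norm_vector_smult)
  qed
  have contM: "continuous_on {0..\<rho>} \<sigma>" "continuous_on {0..\<rho>} \<sigma>'"
    and der: "\<And>t. 0 < t \<Longrightarrow> t < \<rho> \<Longrightarrow> (\<sigma> has_real_derivative \<sigma>' t) (at t)"
      "\<And>t. 0 < t \<Longrightarrow> t < \<rho> \<Longrightarrow> (\<sigma>' has_real_derivative nbody_nu G m q0 * growth (\<sigma> t)) (at t)"
    and \<sigma>'0: "nbody_mu q0 v0 \<le> \<sigma>' 0" and \<sigma>0: "0 \<le> \<sigma> 0"
  proof -
    have "0 \<le> \<rho>" using z norm_ge_zero[of z] by linarith
    then show "0 \<le> \<sigma> 0" using M unfolding majorant_def by simp
  qed (use M in \<open>simp_all add: majorant_def\<close>)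
  have pV0: "norm (p (V 0)) \<le> N * \<sigma>' 0"
  proof (cases "i = j")
    case False
    have "norm (p (V 0)) = norm (v0 $ i - v0 $ j)"
      by (simp add: p_def V0 cconf_def cvec_diff[symmetric])
    also have "\<dots> \<le> nbody_mu q0 v0 * N" unfolding N_def by (rule velocity_le_mu[OF False distinct])
    also have "\<dots> \<le> N * \<sigma>' 0" using \<sigma>'0 N by (simp add: mult.commute mult_left_mono)
    finally show ?thesis .
  qed (simp add: p_def N_def)
  have pV: "norm (p (V w)) \<le> N * \<sigma>' (norm w)" if w: "norm w \<le> \<rho>" for w
  proof -
    have "norm (p (V w) - p (V 0)) \<le> N * \<sigma>' (norm w) - N * \<sigma>' 0"
    proof (rule ray_mean_value[OF VW _ p unit])
      show "continuous_on {0..norm w} (\<lambda>t. N * \<sigma>' t)"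
        using contM(2) w by (intro continuous_intros) (auto intro: continuous_on_subset)
      show "((\<lambda>t. N * \<sigma>' t) has_real_derivative N * (nbody_nu G m q0 * growth (\<sigma> t))) (at t)"
        if "0 < t" "t < norm w" for t
        using der(2)[of t] that w by (intro DERIV_cmult) auto
      show "norm (p (W x)) \<le> N * (nbody_nu G m q0 * growth (\<sigma> (norm x)))"
        if "0 < norm x" "norm x < norm w" for x
        using bound[OF \<rho> M, of x i j] that w by (simp add: p_def N_def mult_ac)
    qed (use w \<rho> in auto)
    then show ?thesis using pV0 norm_triangle_sub[of "p (V w)" "p (V 0)"] by linarith
  qed
  have "norm (p (Q z) - p (Q 0)) \<le> N * \<sigma> (norm z) - N * \<sigma> 0"
  proof (rule ray_mean_value[OF QV _ p unit])
    show "continuous_on {0..norm z} (\<lambda>t. N * \<sigma> t)"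
      using contM(1) z by (intro continuous_intros) (auto intro: continuous_on_subset)
    show "((\<lambda>t. N * \<sigma> t) has_real_derivative N * \<sigma>' t) (at t)" if "0 < t" "t < norm z" for t
      using der(1)[of t] that z by (intro DERIV_cmult) auto
    show "norm (p (V x)) \<le> N * \<sigma>' (norm x)" if "0 < norm x" "norm x < norm z" for x
      using that z by (intro pV) auto
  qed (use z \<rho> in auto)
  also have "\<dots> \<le> N * \<sigma> (norm z)" using N \<sigma>0 by simp
  finally show "norm (Q z $ i - Q z $ j - cvec (q0 $ i - q0 $ j)) \<le> \<sigma> (norm z) * norm (q0 $ i - q0 $ j)"
    by (simp add: p_def N_def Q0 cconf_def cvec_diff mult.commute)
qed


lemma growth_nonneg_majorant:
  assumes "maj \<rho> s \<sigma> \<sigma>'" "norm z \<le> \<rho>"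
  shows "0 \<le> \<sigma> (norm z)" "\<sigma> (norm z) < sqrt 2 - 1" "0 \<le> growth (\<sigma> (norm z))"
proof -
  show 1: "0 \<le> \<sigma> (norm z)" and 2: "\<sigma> (norm z) < sqrt 2 - 1"
    using assms by (auto simp: majorant_def intro: le_less_trans)
  show "0 \<le> growth (\<sigma> (norm z))" using 1 shrink_pos[OF 1 2] by (simp add: growth_def)
qed

lemma picard_step:
  assumes Q: "admissible Q" and QV: "cderiv_on (ball 0 R) Q V"
  obtains Q' V' where "admissible Q'" "cderiv_on (ball 0 R) Q' V'"
    "cderiv_on (ball 0 R) V' (\<lambda>z. cforce G m (Q z))" "Q' 0 = cconf q0" "V' 0 = cconf v0"
proof -
  have holQ: "(\<lambda>z. Q z $ i $ k) holomorphic_on ball 0 R" for i k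
    using QV unfolding cderiv_on_def holomorphic_on_open[OF open_ball] by blast
  have holF: "(\<lambda>z. cforce G m (Q z) $ i $ k) holomorphic_on ball 0 R" for i k
    by (intro cforce_holomorphic holQ admissible_Re_pos[OF Q])
  obtain V' where V': "cderiv_on (ball 0 R) V' (\<lambda>z. cforce G m (Q z))" "V' 0 = cconf v0"
    using cderiv_on_primitive[OF holF] .
  have holV: "(\<lambda>z. V' z $ i $ k) holomorphic_on ball 0 R" for i k
    using V'(1) unfolding cderiv_on_def holomorphic_on_open[OF open_ball] by blast
  obtain Q' where Q': "cderiv_on (ball 0 R) Q' V'" "Q' 0 = cconf q0"
    using cderiv_on_primitive[OF holV] .
  have "admissible Q'"
  proof (rule majorized_admissible[OF Q'(1) V'(1) Q'(2) V'(2)])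
    fix \<rho> s \<sigma> \<sigma>' and z :: complex and i j
    assume "\<rho> < R" and M: "maj \<rho> s \<sigma> \<sigma>'" and z: "norm z \<le> \<rho>"
    then have "spread_within q0 (\<sigma> (norm z)) (Q z)" using Q unfolding admissible_def by blast
    then show "norm (cforce G m (Q z) $ i - cforce G m (Q z) $ j)
      \<le> nbody_nu G m q0 * growth (\<sigma> (norm z)) * norm (q0 $ i - q0 $ j)"
      using growth_nonneg_majorant[OF M z] by (intro cforce_pair_bound G m distinct)
  qed
  with V' Q' show thesis by (intro that)
qed

text \<open>
  The iteration starts with free motion, the case of vanishing force in \<open>majorized_admissible\<close>.
\<close>

lemma picard_sequence:
  obtains P W where "\<And>n. admissible (P n)" "\<And>n. cderiv_on (ball 0 R) (P n) (W n)"
    "\<And>n. P n 0 = cconf q0" "\<And>n. W n 0 = cconf v0" "\<And>n. continuous_on (ball 0 R) (W n)"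
    "\<And>n. cderiv_on (ball 0 R) (W (Suc n)) (\<lambda>z. cforce G m (P n z))"
proof -
  define A where "A = (\<lambda>(Q, V). admissible Q \<and> cderiv_on (ball 0 R) Q V \<and> Q 0 = cconf q0 \<and>
    V 0 = cconf v0 \<and> continuous_on (ball 0 R) V)"
  have "\<exists>f. \<forall>n. A (f n) \<and> cderiv_on (ball 0 R) (snd (f (Suc n))) (\<lambda>z. cforce G m (fst (f n) z))"
  proof (rule dependent_nat_choice)
    define Q where "Q z = cconf q0 + cscale z (cconf v0)" for z
    have 1: "cderiv_on (ball 0 R) Q (\<lambda>z. cconf v0)"
      by (auto simp: cderiv_on_def Q_def cscale_def intro!: derivative_eq_intros)
    have 2: "cderiv_on (ball 0 R) (\<lambda>z. cconf v0 :: complex^3^'n) (\<lambda>z. 0)"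
      by (auto simp: cderiv_on_def)
    have 3: "Q 0 = cconf q0" by (simp add: Q_def cscale_def vec_eq_iff)
    have "admissible Q"
    proof (rule majorized_admissible[OF 1 2 3 refl])
      fix \<rho> s \<sigma> \<sigma>' and z :: complex and i j
      assume "maj \<rho> s \<sigma> \<sigma>'" "norm z \<le> \<rho>"
      from growth_nonneg_majorant(3)[OF this] nu
      show "norm ((0 :: complex^3^'n) $ i - (0 :: complex^3^'n) $ j)
          \<le> nbody_nu G m q0 * growth (\<sigma> (norm z)) * norm (q0 $ i - q0 $ j)"
        by simp
    qed
    then show "\<exists>x. A x" using 1 3 by (intro exI[of _ "(Q, \<lambda>z. cconf v0)"]) (simp add: A_def)
    show "\<exists>y. A y \<and> cderiv_on (ball 0 R) (snd y) (\<lambda>z. cforce G m (fst x z))" if "A x" for x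
    proof -
      obtain Q V where x: "x = (Q, V)" by fastforce
      from that have "admissible Q" "cderiv_on (ball 0 R) Q V" by (auto simp: A_def x)
      from picard_step[OF this] obtain Q' V' where "admissible Q'" "cderiv_on (ball 0 R) Q' V'"
        "cderiv_on (ball 0 R) V' (\<lambda>z. cforce G m (Q z))" "Q' 0 = cconf q0" "V' 0 = cconf v0" .
      then show ?thesis
        by (intro exI[of _ "(Q', V')"]) (auto simp: A_def x dest: cderiv_on_continuous)
    qed
  qed
  then obtain f where f: "\<forall>n. A (f n) \<and> cderiv_on (ball 0 R) (snd (f (Suc n))) (\<lambda>z. cforce G m (fst (f n) z))"
    by (elim exE)
  then have "admissible (fst (f n)) \<and> cderiv_on (ball 0 R) (fst (f n)) (snd (f n)) \<and> fst (f n) 0 = cconf q0 \<and>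
    snd (f n) 0 = cconf v0 \<and> continuous_on (ball 0 R) (snd (f n))" for n
    by (simp add: A_def case_prod_beta)
  then show thesis
    using f by (intro that[of "\<lambda>n. fst (f n)" "\<lambda>n. snd (f n)"]) simp_all
qed


text \<open>
  With $L$ a Lipschitz constant of the force on the disk of radius $\rho$ and $\kappa = \sqrt{2L}$, the
  increments of the iterates are measured in the weight $e^{\kappa|z|}$. Each integration
  along a ray gains a factor $1/\kappa$, so one Picard step contracts by $L/\kappa^2 = 1/2$ on all of
  this disk. The velocities converge as well, which allows passing to the limit in both equations.
\<close>

lemma holomorphic_solution:
  obtains Q V where "cderiv_on (ball 0 R) Q V" "cderiv_on (ball 0 R) V (\<lambda>z. cforce G m (Q z))"
    "Q 0 = cconf q0" "V 0 = cconf v0" "\<And>z i j. z \<in> ball 0 R \<Longrightarrow> i \<noteq> j \<Longrightarrow> 0 < Re (cdot (Q z $ j - Q z $ i))"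
proof -
  obtain P W where P: "\<And>n. admissible (P n)" and PW: "\<And>n. cderiv_on (ball 0 R) (P n) (W n)"
    and P0: "\<And>n. P n 0 = cconf q0" and W0: "\<And>n. W n 0 = cconf v0"
    and Wc: "\<And>n. continuous_on (ball 0 R) (W n)"
    and WF: "\<And>n. cderiv_on (ball 0 R) (W (Suc n)) (\<lambda>z. cforce G m (P n z))"
    using picard_sequence by metis
  have lip: "\<exists>L>0. \<forall>X Y z. admissible X \<longrightarrow> admissible Y \<longrightarrow> norm z \<le> \<rho> \<longrightarrow>
      norm (cforce G m (X z) - cforce G m (Y z)) \<le> L * norm (X z - Y z)" if \<rho>: "0 \<le> \<rho>" "\<rho> < R" for \<rho>
  proof -
    obtain s where s: "0 \<le> s" "s < sqrt 2 - 1"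
      "\<And>Q z. admissible Q \<Longrightarrow> norm z \<le> \<rho> \<Longrightarrow> spread_within q0 s (Q z)"
      using admissible_uniform[OF \<rho>] by metis
    obtain d D where d: "0 < d" and sep: "\<And>Q. spread_within q0 s Q \<Longrightarrow> separated d D Q"
      using spread_within_separated[OF distinct s(1,2)] by metis
    obtain L where "0 < L" "\<And>P Q. separated d D P \<Longrightarrow> separated d D Q \<Longrightarrow>
        norm (cforce G m P - cforce G m Q) \<le> L * norm (P - Q)"
      using cforce_lipschitz[OF d, where G = G and m = m and D = D] by metis
    then show ?thesis by (intro exI[of _ L] conjI allI impI) (simp_all add: s(3) sep)
  qed
  have step: "\<exists>C. \<forall>n z. norm z \<le> \<rho> \<longrightarrow> norm (P (Suc n) z - P n z) \<le> C / 2 ^ n \<and>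
      norm (W (Suc n) z - W n z) \<le> C / 2 ^ n" if \<rho>: "0 \<le> \<rho>" "\<rho> < R" for \<rho>
  proof -
    obtain L where L: "0 < L" and F: "\<And>X Y z. admissible X \<Longrightarrow> admissible Y \<Longrightarrow> norm z \<le> \<rho> \<Longrightarrow>
      norm (cforce G m (X z) - cforce G m (Y z)) \<le> L * norm (X z - Y z)"
      using lip[OF \<rho>] by (elim exE conjE) simp
    define \<kappa> where "\<kappa> = sqrt (2 * L)"
    have \<kappa>: "0 < \<kappa>" "\<kappa> * \<kappa> = 2 * L" using L by (auto simp: \<kappa>_def)
    have sub: "cball 0 \<rho> \<subseteq> ball (0::complex) R" using \<rho> by auto
    have "\<exists>B. \<forall>z\<in>cball 0 \<rho>. norm (f z) \<le> B" if "continuous_on (ball 0 R) f" for f :: "complex \<Rightarrow> complex^3^'n"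
    proof -
      have "bounded (f ` cball 0 \<rho>)"
        by (intro compact_imp_bounded compact_continuous_image continuous_on_subset[OF that sub]) simp
      then show ?thesis by (auto simp: bounded_iff)
    qed
    from this[OF continuous_on_diff[OF cderiv_on_continuous[OF PW] cderiv_on_continuous[OF PW]], of 1 0]
      this[OF continuous_on_diff[OF Wc Wc], of 1 0]
    obtain B1 B2 where B: "\<forall>z\<in>cball 0 \<rho>. norm (P 1 z - P 0 z) \<le> B1" "\<forall>z\<in>cball 0 \<rho>. norm (W 1 z - W 0 z) \<le> B2"
      by (elim exE)
    then have B1: "norm (P 1 z - P 0 z) \<le> B1" and B2: "norm (W 1 z - W 0 z) \<le> B2" if "norm z \<le> \<rho>" for z
      using that by simp_all
    define C where "C = \<bar>B1\<bar> + \<bar>B2\<bar> / \<kappa>"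
    have "0 \<le> \<bar>B2\<bar> / \<kappa>" "0 \<le> \<kappa> * \<bar>B1\<bar>" "\<kappa> * C = \<kappa> * \<bar>B1\<bar> + \<bar>B2\<bar>"
      using \<kappa>(1) by (simp_all add: C_def distrib_left)
    then have C: "0 \<le> C" "B1 \<le> C" "B2 \<le> \<kappa> * C" by (simp_all add: C_def)
    have main: "norm (P (Suc n) z - P n z) \<le> C / 2 ^ n * exp (\<kappa> * norm z) \<and>
        norm (W (Suc n) z - W n z) \<le> \<kappa> * C / 2 ^ n * exp (\<kappa> * norm z)" if "norm z \<le> \<rho>" for n z
      using that
    proof (induction n arbitrary: z)
      case 0
      have e: "1 \<le> exp (\<kappa> * norm z)" using \<kappa> by simp
      have "C * 1 \<le> C * exp (\<kappa> * norm z)" "\<kappa> * C * 1 \<le> \<kappa> * C * exp (\<kappa> * norm z)"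
        using C \<kappa> e by (intro mult_left_mono; simp)+
      then show ?case using B1[OF 0] B2[OF 0] C by simp
    next
      case (Suc n)
      have id: "bounded_linear (\<lambda>x :: complex^3^'n. x)" by (rule bounded_linear_ident)
      have V: "norm (W (Suc (Suc n)) w - W (Suc n) w) \<le> \<kappa> * C / 2 ^ Suc n * exp (\<kappa> * norm w)"
        if w: "norm w \<le> \<rho>" for w
      proof -
        have "norm ((W (Suc (Suc n)) w - W (Suc n) w) - (W (Suc (Suc n)) 0 - W (Suc n) 0))
            \<le> \<kappa> * C / 2 ^ Suc n * exp (\<kappa> * norm w) - \<kappa> * C / 2 ^ Suc n * exp (\<kappa> * 0)"
        proof (rule ray_mean_value[OF cderiv_on_diff[OF WF WF] _ id])
          show "((\<lambda>t. \<kappa> * C / 2 ^ Suc n * exp (\<kappa> * t)) has_real_derivative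
              L * (C / 2 ^ n * exp (\<kappa> * t))) (at t)" for t
          proof -
            have "((\<lambda>t. \<kappa> * C / 2 ^ Suc n * exp (\<kappa> * t)) has_real_derivative
              (\<kappa> * \<kappa>) * C / 2 ^ Suc n * exp (\<kappa> * t)) (at t)"
              by (auto intro!: derivative_eq_intros)
            then show ?thesis by (simp add: \<kappa>(2) mult.assoc)
          qed
          fix x :: complex assume "0 < norm x" "norm x < norm w"
          then have x: "norm x \<le> \<rho>" using w by simp
          have "norm (cforce G m (P (Suc n) x) - cforce G m (P n x)) \<le> L * norm (P (Suc n) x - P n x)"
            by (rule F[OF P P x])
          also have "\<dots> \<le> L * (C / 2 ^ n * exp (\<kappa> * norm x))"
            using Suc.IH[OF x] L by (intro mult_left_mono) auto
          finally show "norm (cforce G m (P (Suc n) x) - cforce G m (P n x)) \<le> L * (C / 2 ^ n * exp (\<kappa> * norm x))" .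
        qed (use w \<rho> in \<open>auto intro!: continuous_intros simp: norm_cscale\<close>)
        moreover have "0 \<le> \<kappa> * C / 2 ^ Suc n * exp (\<kappa> * 0)" using C \<kappa> by simp
        ultimately show ?thesis by (simp add: W0)
      qed
      have "norm ((P (Suc (Suc n)) z - P (Suc n) z) - (P (Suc (Suc n)) 0 - P (Suc n) 0))
          \<le> C / 2 ^ Suc n * exp (\<kappa> * norm z) - C / 2 ^ Suc n * exp (\<kappa> * 0)"
      proof (rule ray_mean_value[OF cderiv_on_diff[OF PW PW] _ id])
        show "((\<lambda>t. C / 2 ^ Suc n * exp (\<kappa> * t)) has_real_derivative
            \<kappa> * C / 2 ^ Suc n * exp (\<kappa> * t)) (at t)" for t
          by (auto intro!: derivative_eq_intros)
        show "norm (W (Suc (Suc n)) x - W (Suc n) x) \<le> \<kappa> * C / 2 ^ Suc n * exp (\<kappa> * norm x)"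
          if "0 < norm x" "norm x < norm z" for x
          using that Suc.prems by (intro V) auto
      qed (use Suc.prems \<rho> in \<open>auto intro!: continuous_intros simp: norm_cscale\<close>)
      moreover have "0 \<le> C / 2 ^ Suc n * exp (\<kappa> * 0)" using C by simp
      ultimately have "norm (P (Suc (Suc n)) z - P (Suc n) z) \<le> C / 2 ^ Suc n * exp (\<kappa> * norm z)"
        by (simp add: P0)
      then show ?case using V[OF Suc.prems] by blast
    qed
    define K where "K = (C + \<kappa> * C) * exp (\<kappa> * \<rho>)"
    have "norm (P (Suc n) z - P n z) \<le> K / 2 ^ n \<and> norm (W (Suc n) z - W n z) \<le> K / 2 ^ n"
      if z: "norm z \<le> \<rho>" for n z
    proof -
      have "exp (\<kappa> * norm z) \<le> exp (\<kappa> * \<rho>)" using z \<kappa> by simp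
      then have "c * exp (\<kappa> * norm z) \<le> K" if "0 \<le> c" "c \<le> C + \<kappa> * C" for c
        unfolding K_def using that by (intro mult_mono) auto
      from this[of C] this[of "\<kappa> * C"] C \<kappa>
      have "C * exp (\<kappa> * norm z) \<le> K" "\<kappa> * C * exp (\<kappa> * norm z) \<le> K" by auto
      then have "C * exp (\<kappa> * norm z) / 2 ^ n \<le> K / 2 ^ n" "\<kappa> * C * exp (\<kappa> * norm z) / 2 ^ n \<le> K / 2 ^ n"
        by (intro divide_right_mono; simp)+
      then show ?thesis using main[OF z, of n] by simp
    qed
    then show ?thesis by (intro exI[of _ K]) simp
  qed
  obtain Q where Q: "\<And>\<rho>. 0 \<le> \<rho> \<Longrightarrow> \<rho> < R \<Longrightarrow> uniform_limit (cball 0 \<rho>) P Q sequentially"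
  proof (rule geometric_steps_uniform_limit[of R P])
    show "\<exists>C. \<forall>n z. norm z \<le> \<rho> \<longrightarrow> norm (P (Suc n) z - P n z) \<le> C / 2 ^ n" if "0 \<le> \<rho>" "\<rho> < R" for \<rho>
      using step[OF that] by (rule ex_forward) simp
  qed metis
  obtain V where V: "\<And>\<rho>. 0 \<le> \<rho> \<Longrightarrow> \<rho> < R \<Longrightarrow> uniform_limit (cball 0 \<rho>) W V sequentially"
  proof (rule geometric_steps_uniform_limit[of R W])
    show "\<exists>C. \<forall>n z. norm z \<le> \<rho> \<longrightarrow> norm (W (Suc n) z - W n z) \<le> C / 2 ^ n" if "0 \<le> \<rho>" "\<rho> < R" for \<rho>
      using step[OF that] by (rule ex_forward) simp
  qed metis
  have limQ: "(\<lambda>n. P n z) \<longlonglongrightarrow> Q z" and limV: "(\<lambda>n. W n z) \<longlonglongrightarrow> V z" if "norm z < R" for z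
    by (rule tendsto_uniform_limitI[OF Q[of "norm z"]] tendsto_uniform_limitI[OF V[of "norm z"]];
        use that in simp)+
  have admQ: "admissible Q"
    unfolding admissible_def spread_within_def
  proof (intro allI impI)
    fix \<rho> s \<sigma> \<sigma>' and z :: complex and i j
    assume a: "\<rho> < R" "maj \<rho> s \<sigma> \<sigma>'" "norm z \<le> \<rho>"
    have "(\<lambda>n. norm ((P n z $ j - P n z $ i) - cvec (q0 $ j - q0 $ i)))
        \<longlonglongrightarrow> norm ((Q z $ j - Q z $ i) - cvec (q0 $ j - q0 $ i))"
      using a by (intro tendsto_intros limQ) auto
    then show "norm (Q z $ j - Q z $ i - cvec (q0 $ j - q0 $ i)) \<le> \<sigma> (norm z) * norm (q0 $ j - q0 $ i)"
    proof (rule LIMSEQ_le_const2)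
      have "spread_within q0 (\<sigma> (norm z)) (P n z)" for n
        using P[of n] a unfolding admissible_def by blast
      then show "\<exists>N. \<forall>n\<ge>N. norm ((P n z $ j - P n z $ i) - cvec (q0 $ j - q0 $ i))
          \<le> \<sigma> (norm z) * norm (q0 $ j - q0 $ i)"
        by (simp add: spread_within_def)
    qed
  qed
  have limF: "(\<lambda>n. cforce G m (P n z)) \<longlonglongrightarrow> cforce G m (Q z)" if z: "norm z < R" for z
  proof -
    obtain L where L: "\<And>X Y. admissible X \<Longrightarrow> admissible Y \<Longrightarrow>
      norm (cforce G m (X z) - cforce G m (Y z)) \<le> L * norm (X z - Y z)"
      using lip[of "norm z"] z by auto
    have "(\<lambda>n. L * norm (P n z - Q z)) \<longlonglongrightarrow> L * norm (Q z - Q z)"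
      by (intro tendsto_intros limQ z)
    then have "(\<lambda>n. L * norm (P n z - Q z)) \<longlonglongrightarrow> 0" by simp
    then show ?thesis
      by (rule Lim_null_comparison[THEN LIM_zero_cancel, rotated]) (use L P admQ in auto)
  qed
  show thesis
  proof (rule that)
    show "cderiv_on (ball 0 R) Q V"
      by (rule cderiv_on_uniform_limit[OF Q PW]) (use limV in auto)
    show "cderiv_on (ball 0 R) V (\<lambda>z. cforce G m (Q z))"
    proof (rule cderiv_on_uniform_limit[where P = "\<lambda>n. W (Suc n)"])
      show "uniform_limit (cball 0 \<rho>) (\<lambda>n. W (Suc n)) V sequentially" if "0 \<le> \<rho>" "\<rho> < R" for \<rho>
        by (rule filterlim_compose[OF V[OF that] filterlim_Suc])
      show "(\<lambda>n. cforce G m (P n z)) \<longlonglongrightarrow> cforce G m (Q z)" if "z \<in> ball 0 R" for z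
        using limF that by simp
    qed (rule WF)
    show "Q 0 = cconf q0" using limQ[of 0] R P0 by (simp add: LIMSEQ_const_iff)
    show "V 0 = cconf v0" using limV[of 0] R W0 by (simp add: LIMSEQ_const_iff)
  qed (rule admissible_Re_pos[OF admQ])
qed

end

section \<open>Uniqueness in real time\<close>

lemma gronwall_zero:
  fixes e e' :: "real \<Rightarrow> real"
  assumes T: "0 \<le> T" and der: "\<And>t. t \<in> {0..T} \<Longrightarrow> (e has_real_derivative e' t) (at t)"
    and le: "\<And>t. t \<in> {0..T} \<Longrightarrow> e' t \<le> C * e t" and e0: "e 0 = 0"
  shows "e T \<le> 0"
proof -
  have "e T * exp (- C * T) \<le> e 0 * exp (- C * 0)"
  proof (rule DERIV_nonpos_imp_nonincreasing[OF T, where f = "\<lambda>t. e t * exp (- C * t)"])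
    fix t assume "0 \<le> t" "t \<le> T"
    then have t: "t \<in> {0..T}" by simp
    have "((\<lambda>t. e t * exp (- C * t)) has_real_derivative (e' t - C * e t) * exp (- C * t)) (at t)"
      by (auto intro!: derivative_eq_intros der[OF t] simp: algebra_simps)
    moreover have "(e' t - C * e t) * exp (- C * t) \<le> 0"
      using le[OF t] by (simp add: mult_le_0_iff)
    ultimately show "\<exists>y. ((\<lambda>t. e t * exp (- C * t)) has_real_derivative y) (at t) \<and> y \<le> 0" by blast
  qed
  then show ?thesis by (simp add: e0 mult_le_0_iff)
qed

text \<open>
  Solutions of the complexified equations in real time. Positivity of the real part plays the part of
  freedom from collisions and keeps clear of the branch cut.
\<close>

definition csolution ::
  "real \<Rightarrow> real^'n \<Rightarrow> real set \<Rightarrow> (real \<Rightarrow> complex^3^'n) \<Rightarrow> (real \<Rightarrow> complex^3^'n) \<Rightarrow> bool" where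
  "csolution G m S Q V \<longleftrightarrow> (\<forall>t\<in>S. (Q has_vector_derivative V t) (at t) \<and>
     (V has_vector_derivative cforce G m (Q t)) (at t) \<and>
     (\<forall>i j. i \<noteq> j \<longrightarrow> 0 < Re (cdot (Q t $ j - Q t $ i))))"

text \<open>
  Using the single parameter \<open>d\<close> for both bounds lets the constants for several pairs of bodies, and
  for two solutions, be merged as eventualities at \<open>0\<close>.
\<close>

lemma csolution_separated:
  fixes Q V :: "real \<Rightarrow> complex^3^'n"
  assumes sol: "csolution G m {a..b} Q V"
  shows "\<forall>\<^sub>F d in at_right 0. \<forall>t\<in>{a..b}. separated d (1 / d) (Q t)"
proof -
  have cont: "continuous_on {a..b} Q"
    using sol unfolding csolution_def
    by (intro continuous_at_imp_continuous_on ballI) (blast intro: has_vector_derivative_continuous)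
  have "\<forall>\<^sub>F d in at_right 0. \<forall>i j. i \<noteq> j \<longrightarrow> (\<forall>t\<in>{a..b}. d\<^sup>2 \<le> Re (cdot (Q t $ j - Q t $ i)))"
  proof (intro eventually_all_finite)
    fix i j :: 'n
    have "\<forall>\<^sub>F d in at_right 0. \<forall>t\<in>{a..b}. d\<^sup>2 \<le> Re (cdot (Q t $ j - Q t $ i))" if "i \<noteq> j"
    proof (cases "{a..b} = {}")
      case False
      have "continuous_on {a..b} (\<lambda>t. Re (cdot (Q t $ j - Q t $ i)))"
        unfolding cdot_def by (intro continuous_intros cont)
      from continuous_attains_inf[OF compact_Icc False this]
      obtain x where x: "x \<in> {a..b}" "\<And>t. t \<in> {a..b} \<Longrightarrow> Re (cdot (Q x $ j - Q x $ i)) \<le> Re (cdot (Q t $ j - Q t $ i))"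
        by blast
      define h where "h = Re (cdot (Q x $ j - Q x $ i))"
      have "0 < h" using sol x(1) that by (auto simp: csolution_def h_def)
      then have "0 < sqrt h" by simp
      from eventually_at_right_real[OF this] show ?thesis
      proof eventually_elim
        case (elim d)
        then have "d\<^sup>2 \<le> (sqrt h)\<^sup>2" by (intro power_mono) auto
        then have "d\<^sup>2 \<le> h" using \<open>0 < h\<close> by simp
        then show ?case using x(2) order_trans unfolding h_def by blast
      qed
    qed simp
    then show "\<forall>\<^sub>F d in at_right 0. i \<noteq> j \<longrightarrow> (\<forall>t\<in>{a..b}. d\<^sup>2 \<le> Re (cdot (Q t $ j - Q t $ i)))"
      by (cases "i = j") simp_all
  qed
  moreover have "\<forall>\<^sub>F d in at_right 0. \<forall>t\<in>{a..b}. \<forall>i j. norm (Q t $ j - Q t $ i) \<le> 1 / d"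
  proof -
    have "bounded (Q ` {a..b})"
      by (intro compact_imp_bounded compact_continuous_image cont compact_Icc)
    then obtain B where B: "0 < B" "\<forall>x\<in>Q ` {a..b}. norm x \<le> B" unfolding bounded_pos by blast
    then have "0 < 1 / (2 * B)" by simp
    from eventually_at_right_real[OF this] show ?thesis
    proof eventually_elim
      case (elim d)
      then have d: "2 * B \<le> 1 / d" using B(1) by (simp add: field_simps)
      show ?case
      proof (intro ballI allI)
        fix t i j assume "t \<in> {a..b}"
        then have "norm (Q t) \<le> B" using B(2) by blast
        then show "norm (Q t $ j - Q t $ i) \<le> 1 / d"
          using norm_triangle_ineq4[of "Q t $ j" "Q t $ i"] d
            Finite_Cartesian_Product.norm_nth_le[of "Q t" i] Finite_Cartesian_Product.norm_nth_le[of "Q t" j]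
          by linarith
      qed
    qed
  qed
  ultimately show ?thesis
    by eventually_elim (simp add: separated_def)
qed

text \<open>
  Gronwall's inequality for the squared distance $e = \|A\|^2 + \|B\|^2$ of the two solutions in phase
  space: on a compact time interval both stay in a common region where the force is Lipschitz, so
  $e' \le (1 + L)\,e$.
\<close>

lemma csolution_unique_forward:
  fixes Q V P W :: "real \<Rightarrow> complex^3^'n"
  assumes T: "0 \<le> T" and Q: "csolution G m {0..T} Q V" and P: "csolution G m {0..T} P W"
    and init: "Q 0 = P 0" "V 0 = W 0"
  shows "Q T = P T \<and> V T = W T"
proof -
  have "\<forall>\<^sub>F d in at_right (0::real). 0 < d" by (simp add: eventually_at_right_less)
  then have ev: "\<forall>\<^sub>F d in at_right 0. 0 < d \<and> (\<forall>t\<in>{0..T}. separated d (1 / d) (Q t)) \<and>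
      (\<forall>t\<in>{0..T}. separated d (1 / d) (P t))"
    by (intro eventually_conj csolution_separated[OF Q] csolution_separated[OF P])
  from eventually_happens'[OF trivial_limit_at_right_real ev]
  obtain d where d: "0 < d" and sep: "\<forall>t\<in>{0..T}. separated d (1 / d) (Q t)" "\<forall>t\<in>{0..T}. separated d (1 / d) (P t)"
    by (elim exE conjE)
  obtain L where L: "0 < L" and lip: "\<And>X Y. separated d (1 / d) X \<Longrightarrow> separated d (1 / d) Y \<Longrightarrow>
      norm (cforce G m X - cforce G m Y) \<le> L * norm (X - Y)"
    using cforce_lipschitz[OF d, where G = G and m = m and D = "1 / d"] by metis
  define A where "A t = Q t - P t" for t
  define B where "B t = V t - W t" for t
  define F where "F t = cforce G m (Q t) - cforce G m (P t)" for t
  define e where "e t = A t \<bullet> A t + B t \<bullet> B t" for t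
  have A: "(A has_vector_derivative B t) (at t)" and B: "(B has_vector_derivative F t) (at t)" if "t \<in> {0..T}" for t
  proof -
    show "(A has_vector_derivative B t) (at t)"
      using Q P that unfolding csolution_def A_def[abs_def] B_def
      by (intro has_vector_derivative_diff) simp_all
    show "(B has_vector_derivative F t) (at t)"
      using Q P that unfolding csolution_def B_def[abs_def] F_def
      by (intro has_vector_derivative_diff) simp_all
  qed
  have "e T \<le> 0"
  proof (rule gronwall_zero[OF T])
    fix t assume t: "t \<in> {0..T}"
    show "(e has_real_derivative (A t \<bullet> B t + B t \<bullet> A t) + (B t \<bullet> F t + F t \<bullet> B t)) (at t)"
      unfolding has_real_derivative_iff_has_vector_derivative e_def[abs_def]
      by (intro has_vector_derivative_add bounded_bilinear.has_vector_derivative[OF bounded_bilinear_inner] A B t)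
    have F: "norm (F t) \<le> L * norm (A t)"
      unfolding F_def A_def
      using sep t by (intro lip) simp_all
    have sq: "2 * (norm (A t) * norm (B t)) \<le> e t"
      using sum_squares_bound[of "norm (A t)" "norm (B t)"]
      by (simp add: e_def dot_square_norm)
    have "A t \<bullet> B t \<le> norm (A t) * norm (B t)" by (rule norm_cauchy_schwarz)
    moreover have "B t \<bullet> F t \<le> L * (norm (A t) * norm (B t))"
      using norm_cauchy_schwarz[of "B t" "F t"] mult_left_mono[OF F norm_ge_zero[of "B t"]] by (simp add: mult_ac)
    ultimately have "(A t \<bullet> B t + B t \<bullet> A t) + (B t \<bullet> F t + F t \<bullet> B t)
        \<le> 2 * (norm (A t) * norm (B t)) + L * (2 * (norm (A t) * norm (B t)))"
      by (simp add: inner_commute)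
    also have "\<dots> \<le> e t + L * e t" using sq L by (intro add_mono mult_left_mono) auto
    finally show "(A t \<bullet> B t + B t \<bullet> A t) + (B t \<bullet> F t + F t \<bullet> B t) \<le> (1 + L) * e t"
      by (simp add: algebra_simps)
  qed (simp add: e_def A_def B_def init)
  moreover have "0 \<le> A T \<bullet> A T" "0 \<le> B T \<bullet> B T" by simp_all
  ultimately have "A T \<bullet> A T = 0" "B T \<bullet> B T = 0" unfolding e_def by linarith+
  then show ?thesis by (simp add: A_def B_def)
qed

lemma has_vector_derivative_reflect:
  fixes f :: "real \<Rightarrow> 'a::real_normed_vector"
  assumes "(f has_vector_derivative f') (at (- t))"
  shows "((\<lambda>t. f (- t)) has_vector_derivative - f') (at t)"
proof -
  have "(uminus has_vector_derivative - 1) (at t)"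
    using has_vector_derivative_minus[OF has_vector_derivative_id] by simp
  from vector_diff_chain_at[OF this assms] show ?thesis by (simp add: o_def)
qed

text \<open>
  The equations are reversible in time, which reduces negative times to positive ones.
\<close>

lemma csolution_reflect:
  assumes "csolution G m S Q V"
  shows "csolution G m (uminus ` S) (\<lambda>t. Q (- t)) (\<lambda>t. - V (- t))"
  unfolding csolution_def
proof (intro ballI conjI allI impI)
  fix t assume "t \<in> uminus ` S"
  then have t: "- t \<in> S" by auto
  show "((\<lambda>t. Q (- t)) has_vector_derivative - V (- t)) (at t)"
    using assms t by (intro has_vector_derivative_reflect) (simp add: csolution_def)
  have "((\<lambda>t. V (- t)) has_vector_derivative - cforce G m (Q (- t))) (at t)"
    using assms t by (intro has_vector_derivative_reflect) (simp add: csolution_def)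
  from has_vector_derivative_minus[OF this]
  show "((\<lambda>t. - V (- t)) has_vector_derivative cforce G m (Q (- t))) (at t)" by simp
  show "0 < Re (cdot (Q (- t) $ j - Q (- t) $ i))" if "i \<noteq> j" for i j
    using assms t that by (simp add: csolution_def)
qed

lemma csolution_unique:
  fixes Q V P W :: "real \<Rightarrow> complex^3^'n"
  assumes S: "is_interval S" "0 \<in> S" "T \<in> S" and Q: "csolution G m S Q V" and P: "csolution G m S P W"
    and init: "Q 0 = P 0" "V 0 = W 0"
  shows "Q T = P T \<and> V T = W T"
proof -
  have mono: "csolution G m A Q V \<Longrightarrow> B \<subseteq> A \<Longrightarrow> csolution G m B Q V" for A B and Q V :: "real \<Rightarrow> complex^3^'n"
    unfolding csolution_def by blast
  show ?thesis
  proof (cases "0 \<le> T")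
    case True
    have "{0..T} \<subseteq> S" by (intro subsetI mem_is_interval_1_I[OF S]) simp_all
    then show ?thesis by (intro csolution_unique_forward[OF True mono[OF Q] mono[OF P] init])
  next
    case False
    have sub: "{0..-T} \<subseteq> uminus ` S"
    proof
      fix t assume "t \<in> {0..-T}"
      then have "- t \<in> S" by (intro mem_is_interval_1_I[OF S(1,3,2)]) simp_all
      then show "t \<in> uminus ` S" using image_eqI[of t uminus "- t" S] by simp
    qed
    have "Q (- (- T)) = P (- (- T)) \<and> - V (- (- T)) = - W (- (- T))"
      by (rule csolution_unique_forward[OF _ mono[OF csolution_reflect[OF Q] sub] mono[OF csolution_reflect[OF P] sub]])
        (use False init in simp_all)
    then show ?thesis by simp
  qed
qed

section \<open>Real and complex solutions\<close>

lemma bounded_linear_cvec: "bounded_linear (cvec :: real^'k \<Rightarrow> complex^'k)"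
  by (rule bounded_linear_intro[where K = 1]) (simp_all, simp_all add: cvec_def vec_eq_iff scaleR_complex.ctr complex_eq_iff)

lemma has_vector_derivative_cconf:
  assumes "\<And>i. ((\<lambda>s. q s $ i) has_vector_derivative v $ i) (at t)"
  shows "((\<lambda>s. cconf (q s)) has_vector_derivative cconf v) (at t)"
  by (rule has_vector_derivative_vec)
    (use bounded_linear.has_vector_derivative[OF bounded_linear_cvec assms] in \<open>simp add: cconf_def\<close>)

lemma nbody_solution_csolution:
  fixes q v :: "real \<Rightarrow> real^3^'n"
  assumes "nbody_solution G m q0 v0 J q v"
  shows "csolution G m J (\<lambda>t. cconf (q t)) (\<lambda>t. cconf (v t))"
  unfolding csolution_def
proof (intro ballI conjI allI impI)
  fix t assume t: "t \<in> J"
  have ne: "q t $ i \<noteq> q t $ j" if "i \<noteq> j" for i j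
    using assms t that by (simp add: nbody_solution_def)
  show "((\<lambda>t. cconf (q t)) has_vector_derivative cconf (v t)) (at t)"
    using assms t by (intro has_vector_derivative_cconf) (simp add: nbody_solution_def)
  have "((\<lambda>t. cconf (v t)) has_vector_derivative cconf (\<chi> i. nbody_accel G m (q t) i)) (at t)"
    using assms t by (intro has_vector_derivative_cconf) (simp add: nbody_solution_def)
  moreover have "cconf (\<chi> i. nbody_accel G m (q t) i) = cforce G m (cconf (q t))"
    by (subst vec_eq_iff) (simp add: cvec_nbody_accel[OF ne] cconf_def[of "vec_lambda _"])
  ultimately show "((\<lambda>t. cconf (v t)) has_vector_derivative cforce G m (cconf (q t))) (at t)" by simp
  fix i j :: 'n assume "i \<noteq> j"
  then show "0 < Re (cdot (cconf (q t) $ j - cconf (q t) $ i))"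
    using ne[of j i] by (simp add: cconf_def cvec_diff[symmetric] cdot_cvec)
qed

lemma cderiv_on_csolution:
  fixes Q V :: "complex \<Rightarrow> complex^3^'n"
  assumes "cderiv_on (ball 0 R) Q V" "cderiv_on (ball 0 R) V (\<lambda>z. cforce G m (Q z))"
    and pos: "\<And>z i j. z \<in> ball 0 R \<Longrightarrow> i \<noteq> j \<Longrightarrow> 0 < Re (cdot (Q z $ j - Q z $ i))"
  shows "csolution G m {-R<..<R} (\<lambda>t. Q (of_real t)) (\<lambda>t. V (of_real t))"
  unfolding csolution_def
proof (intro ballI conjI allI impI)
  fix t assume "t \<in> {-R<..<R}"
  then have t: "of_real t * 1 \<in> ball (0::complex) R" by auto
  have one: "cscale 1 x = x" for x :: "complex^3^'n" by (simp add: cscale_def vec_eq_iff)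
  show "((\<lambda>t. Q (of_real t)) has_vector_derivative V (of_real t)) (at t)"
    using cderiv_on_ray[OF assms(1) t] by (simp add: one)
  show "((\<lambda>t. V (of_real t)) has_vector_derivative cforce G m (Q (of_real t))) (at t)"
    using cderiv_on_ray[OF assms(2) t] by (simp add: one)
  show "0 < Re (cdot (Q (of_real t) $ j - Q (of_real t) $ i))" if "i \<noteq> j" for i j
    using pos[of "of_real t" i j] t that by simp
qed

lemma norm_vcnj: "norm (vcnj x) = norm x"
  by (simp add: vcnj_def norm_vec_def)

lemma bounded_linear_vcnj: "bounded_linear vcnj"
  by (rule bounded_linear_intro[where K = 1]) (simp_all add: norm_vcnj, simp_all add: vcnj_def vec_eq_iff)

text \<open>
  The force commutes with conjugation since its coefficients are real and the principal branch of the
  root is symmetric.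
\<close>

lemma csolution_vcnj:
  assumes "csolution G m S Q V"
  shows "csolution G m S (\<lambda>t. vcnj (Q t)) (\<lambda>t. vcnj (V t))"
  unfolding csolution_def
proof (intro ballI conjI allI impI)
  fix t assume t: "t \<in> S"
  have *: "0 < Re (cdot (Q t $ j - Q t $ i))" if "i \<noteq> j" for i j
    using assms t that by (simp add: csolution_def)
  show "((\<lambda>t. vcnj (Q t)) has_vector_derivative vcnj (V t)) (at t)"
    using assms t by (intro bounded_linear.has_vector_derivative[OF bounded_linear_vcnj]) (simp add: csolution_def)
  have "((\<lambda>t. vcnj (V t)) has_vector_derivative vcnj (cforce G m (Q t))) (at t)"
    using assms t by (intro bounded_linear.has_vector_derivative[OF bounded_linear_vcnj]) (simp add: csolution_def)
  then show "((\<lambda>t. vcnj (V t)) has_vector_derivative cforce G m (vcnj (Q t))) (at t)"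
    by (simp add: cforce_vcnj[OF *])
  show "0 < Re (cdot (vcnj (Q t) $ j - vcnj (Q t) $ i))" if "i \<noteq> j" for i j
    using *[OF that] by (simp add: cdot_vcnj)
qed

definition rpart :: "complex^'k^'n \<Rightarrow> real^'k^'n" where
  "rpart x = (\<chi> i. \<chi> k. Re (x $ i $ k))"

lemma cconf_rpart: "vcnj x = x \<Longrightarrow> cconf (rpart x) = x"
  by (simp add: vcnj_def cconf_def cvec_def rpart_def vec_eq_iff complex_eq_iff)

lemma rpart_cconf: "rpart (cconf q) = q"
  by (simp add: cconf_def cvec_def rpart_def vec_eq_iff)

lemma vcnj_cconf: "vcnj (cconf q) = cconf q"
  by (simp add: vcnj_def cconf_def cvec_def vec_eq_iff)

text \<open>
  A solution with real initial data coincides with its conjugate by uniqueness, hence it is real.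
\<close>

lemma csolution_real:
  fixes Q V :: "real \<Rightarrow> complex^3^'n"
  assumes sol: "csolution G m {-R<..<R} Q V" and R: "0 < R" and init: "Q 0 = cconf q0" "V 0 = cconf v0"
  shows "nbody_solution G m q0 v0 {-R<..<R} (\<lambda>t. rpart (Q t)) (\<lambda>t. rpart (V t))"
proof -
  have "vcnj (Q t) = Q t \<and> vcnj (V t) = V t" if "t \<in> {-R<..<R}" for t
    by (rule csolution_unique[OF _ _ that csolution_vcnj[OF sol] sol])
      (use R in \<open>auto simp: init vcnj_cconf\<close>)
  then have Qr: "cconf (rpart (Q t)) = Q t" if "t \<in> {-R<..<R}" for t
    using that cconf_rpart by blast
  have der: "((\<lambda>s. rpart (f s) $ i) has_vector_derivative rpart f' $ i) (at t)"
    if "(f has_vector_derivative f') (at t)" for f f' i and t :: real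
  proof (rule has_vector_derivative_vec)
    fix k
    have "((\<lambda>s. Re (f s $ i $ k)) has_vector_derivative Re (f' $ i $ k)) (at t)"
      by (intro bounded_linear.has_vector_derivative[OF bounded_linear_Re]
          bounded_linear.has_vector_derivative[OF bounded_linear_vec_nth] that)
    then show "((\<lambda>s. rpart (f s) $ i $ k) has_vector_derivative rpart f' $ i $ k) (at t)"
      by (simp add: rpart_def)
  qed
  have ne: "rpart (Q t) $ i \<noteq> rpart (Q t) $ j" if t: "t \<in> {-R<..<R}" and "i \<noteq> j" for t i j
  proof
    assume "rpart (Q t) $ i = rpart (Q t) $ j"
    then have "Q t $ i = Q t $ j" using Qr[OF t] by (metis cconf_def vec_lambda_beta)
    moreover have "0 < Re (cdot (Q t $ j - Q t $ i))" using sol that by (simp add: csolution_def)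
    ultimately show False by (simp add: cdot_def)
  qed
  have "((\<lambda>s. rpart (Q s) $ i) has_vector_derivative rpart (V t) $ i) (at t)"
    "((\<lambda>s. rpart (V s) $ i) has_vector_derivative nbody_accel G m (rpart (Q t)) i) (at t)"
    if t: "t \<in> {-R<..<R}" for t i
  proof -
    show "((\<lambda>s. rpart (Q s) $ i) has_vector_derivative rpart (V t) $ i) (at t)"
      using sol t by (intro der) (simp add: csolution_def)
    have "((\<lambda>s. rpart (V s) $ i) has_vector_derivative rpart (cforce G m (Q t)) $ i) (at t)"
      using sol t by (intro der) (simp add: csolution_def)
    moreover have "rpart (cforce G m (Q t)) $ i = nbody_accel G m (rpart (Q t)) i"
    proof -
      have "cforce G m (Q t) $ i = cvec (nbody_accel G m (rpart (Q t)) i)"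
        using cvec_nbody_accel[OF ne[OF t]] Qr[OF t] by simp
      then show ?thesis by (simp add: rpart_def cvec_def vec_eq_iff)
    qed
    ultimately show "((\<lambda>s. rpart (V s) $ i) has_vector_derivative nbody_accel G m (rpart (Q t)) i) (at t)"
      by simp
  qed
  then show ?thesis
    unfolding nbody_solution_def using R by (intro conjI ballI allI impI ne) (simp_all add: init rpart_cconf is_interval_oo)
qed

section \<open>The disk of holomorphy\<close>

lemma nbody_nu_pos:
  fixes q0 :: "real^3^'n"
  assumes "CARD('n) \<ge> 2" "G > 0" "\<And>i. m $ i > 0" and distinct: "\<And>i j. i \<noteq> j \<Longrightarrow> q0 $ i \<noteq> q0 $ j"
  shows "0 < nbody_nu G m q0"
proof -
  have "\<not> (\<forall>i\<in>UNIV. \<forall>j\<in>UNIV. i = (j :: 'n))"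
    using assms(1) by (subst card_le_Suc0_iff_eq[symmetric]) simp_all
  then obtain i j :: 'n where ij: "i \<noteq> j" by blast
  have K: "0 < nbody_K G m q0 i" if "i \<noteq> j" for i j
    unfolding nbody_K_def
  proof (rule sum_pos)
    show "0 < G * m $ k / (norm (q0 $ i - q0 $ k))\<^sup>2" if "k \<in> UNIV - {i}" for k
      using that distinct[of i k] assms(2,3) by simp
  qed (use that in auto)
  have "0 < nbody_M G m q0 i j" using K[OF ij] K[of j i] ij by (simp add: nbody_M_def)
  also have "\<dots> \<le> nbody_nu G m q0 * norm (q0 $ i - q0 $ j)" by (rule nbody_M_le_nu[OF ij distinct])
  finally show ?thesis by (simp add: zero_less_mult_iff)
qed

theorem corollary1:
  fixes G :: real and m :: "real^'n" and q0 v0 :: "real^3^'n"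
  defines "R \<equiv> nbody_radius G m q0 v0"
  assumes "CARD('n) \<ge> 2"
    and "G > 0"
    and "\<And>i. m $ i > 0"
    and "\<And>i j. i \<noteq> j \<Longrightarrow> q0 $ i \<noteq> q0 $ j"
  shows "(\<exists>q v. nbody_solution G m q0 v0 {-R<..<R} q v) \<and>
    (\<exists>(Q :: complex \<Rightarrow> complex^3^'n) (V :: complex \<Rightarrow> complex^3^'n).
       (\<forall>i k. (\<lambda>z. Q z $ i $ k) holomorphic_on ball 0 R \<and>
              (\<lambda>z. V z $ i $ k) holomorphic_on ball 0 R) \<and>
       (\<forall>J q v. nbody_solution G m q0 v0 J q v \<longrightarrow>
          (\<forall>t\<in>J. \<bar>t\<bar> < R \<longrightarrow>
             (\<forall>i k. Q (of_real t) $ i $ k = of_real (q t $ i $ k) \<and>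
                    V (of_real t) $ i $ k = of_real (v t $ i $ k)))))"
proof -
  note nu = nbody_nu_pos[OF assms(2-5)]
  have R_eq: "R = integral {0..sqrt 2 - 1} (\<lambda>x. 1 / sqrt (energy (nbody_mu q0 v0) (nbody_nu G m q0) x))"
    unfolding R_def nbody_radius_def nbody_eta_def by (rule nbody_r_eq_escape_time[OF nu])
  have R: "0 < R" unfolding R_eq by (rule escape_time_pos[OF nu])
  interpret majorized_nbody G m q0 v0 R
  proof
    show "\<exists>s \<sigma> \<sigma>'. majorant (nbody_mu q0 v0) (nbody_nu G m q0) \<rho> s \<sigma> \<sigma>'" if "0 \<le> \<rho>" "\<rho> < R" for \<rho>
      using majorant_exists[OF nu that(2)[unfolded R_eq]] by metis
  qed (use assms R nu in auto)
  obtain Q V where QV: "cderiv_on (ball 0 R) Q V" "cderiv_on (ball 0 R) V (\<lambda>z. cforce G m (Q z))"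
    and init: "Q 0 = cconf q0" "V 0 = cconf v0"
    and pos: "\<And>z i j. z \<in> ball 0 R \<Longrightarrow> i \<noteq> j \<Longrightarrow> 0 < Re (cdot (Q z $ j - Q z $ i))"
    using holomorphic_solution by metis
  have sol: "csolution G m {-R<..<R} (\<lambda>t. Q (of_real t)) (\<lambda>t. V (of_real t))"
    by (rule cderiv_on_csolution[OF QV pos])
  have agree: "Q (of_real t) = cconf (q t) \<and> V (of_real t) = cconf (v t)"
    if qv: "nbody_solution G m q0 v0 J q v" and t: "t \<in> J" "\<bar>t\<bar> < R" for J q v t
  proof (rule csolution_unique[where S = "J \<inter> {-R<..<R}"])
    show "is_interval (J \<inter> {-R<..<R})"
      using qv by (intro is_interval_Int is_interval_oo) (simp add: nbody_solution_def)
    show "csolution G m (J \<inter> {-R<..<R}) (\<lambda>t. cconf (q t)) (\<lambda>t. cconf (v t))"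
      using nbody_solution_csolution[OF qv] by (simp add: csolution_def)
    show "csolution G m (J \<inter> {-R<..<R}) (\<lambda>t. Q (of_real t)) (\<lambda>t. V (of_real t))"
      using sol by (simp add: csolution_def)
  qed (use qv t R init in \<open>auto simp: nbody_solution_def\<close>)
  show ?thesis
  proof (intro conjI exI allI impI ballI)
    show "nbody_solution G m q0 v0 {-R<..<R} (\<lambda>t. rpart (Q (of_real t))) (\<lambda>t. rpart (V (of_real t)))"
      by (rule csolution_real[OF sol R]) (simp_all add: init)
    show "(\<lambda>z. Q z $ i $ k) holomorphic_on ball 0 R" "(\<lambda>z. V z $ i $ k) holomorphic_on ball 0 R" for i k
      using QV unfolding cderiv_on_def holomorphic_on_open[OF open_ball] by blast+
    fix J q v t i k
    assume qv: "nbody_solution G m q0 v0 J q v" and t: "t \<in> J" "\<bar>t\<bar> < R"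
    show "Q (of_real t) $ i $ k = of_real (q t $ i $ k)" "V (of_real t) $ i $ k = of_real (v t $ i $ k)"
      using agree[OF qv t] by (simp_all add: cconf_def cvec_def)
  qed
qed

end
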